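(* For every solvable group $\Gamma$, $\operatorname{asdim}\Gamma\le h(\Gamma)$, where $h(\Gamma)$ is the Hirsch length of $\Gamma$.
   Context: Asymptotic dimension of a metric space: a metric space $X$ has $\operatorname{asdim} X\le n$ if for every $d>0$ there are $R$ and $n+1$ families $\mathcal U_0,\dots,\mathcal U_n$ of subsets of $X$ whose union covers $X$, such that each $\mathcal U_i$ is $R$-bounded (every member has diameter at most $R$) and $d$-disjoint (the distance between $x\in U$ and $y\in V$ is $>d$ whenever $U\ne V$ are members of $\mathcal U_i$). $\operatorname{asdim}X$ is the least such $n$, or $\infty$ if none exists. A metric $d$ on a group is left invariant if $d(gx,gy)=d(x,y)$ for all $g,x,y$, and proper if all closed balls are compact. For a countable (discrete) group, $\operatorname{asdim}$ is the asymptotic dimension of the group with any proper left invariant metric (all closed balls finite); such a metric exists and the value does not depend on its choice. For a finitely generated group, the word metric of a finite generating set is such a metric. For an arbitrary group $G$, $\operatorname{asdim} G=\sup\{\operatorname{asdim} F\mid F\subset G \text{ a finitely generated subgroup}\}$ (this agrees with the previous definition when $G$ is countable). Hirsch length: for a solvable group $\Gamma$, let $1=G_0\subset G_1\subset\dots\subset G_n=\Gamma$ be the commutator (derived) series, $G_i=[G_{i+1},G_{i+1}]$. Then $$h(\Gamma)=\sum_{i}\dim_{\mathbb Q}\big((G_{i+1}/G_i)\otimes\mathbb Q\big),$$ where the tensor product is over $\mathbb Z$; an infinite dimension is counted as $\infty$. *)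

theory Defs
  imports
    "HOL-Algebra.Solvable_Groups"
    "HOL-Algebra.Free_Abelian_Groups"
    "HOL-Analysis.Abstract_Metric_Spaces"
    "HOL-Library.Extended_Nat"
    "Jordan_Normal_Form.VS_Connect"
begin

section \<open>Asymptotic dimension of a metric space\<close>

definition bounded_family :: "('a \<Rightarrow> 'a \<Rightarrow> real) \<Rightarrow> real \<Rightarrow> 'a set set \<Rightarrow> bool" where
  "bounded_family d R \<U> \<longleftrightarrow> (\<forall>U\<in>\<U>. \<forall>x\<in>U. \<forall>y\<in>U. d x y \<le> R)"

definition disjoint_family_at_scale :: "('a \<Rightarrow> 'a \<Rightarrow> real) \<Rightarrow> real \<Rightarrow> 'a set set \<Rightarrow> bool" where
  "disjoint_family_at_scale d r \<U> \<longleftrightarrow>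
     (\<forall>U\<in>\<U>. \<forall>V\<in>\<U>. U \<noteq> V \<longrightarrow> (\<forall>x\<in>U. \<forall>y\<in>V. d x y > r))"

definition asdim_le :: "'a set \<Rightarrow> ('a \<Rightarrow> 'a \<Rightarrow> real) \<Rightarrow> nat \<Rightarrow> bool" where
  "asdim_le M d n \<longleftrightarrow>
     (\<forall>r>0. \<exists>R. \<exists>\<U> :: nat \<Rightarrow> 'a set set.
        (\<Union>i\<le>n. \<Union> (\<U> i)) = M \<and>
        (\<forall>i\<le>n. bounded_family d R (\<U> i) \<and> disjoint_family_at_scale d r (\<U> i)))"

definition asdim :: "'a set \<Rightarrow> ('a \<Rightarrow> 'a \<Rightarrow> real) \<Rightarrow> enat" where
  "asdim M d = Inf {enat n |n. asdim_le M d n}"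


section \<open>Asymptotic dimension of a group\<close>

text \<open>The group is discrete, so properness (compact closed balls) says that closed balls are finite.
  \<open>Metric_space\<close> also demands nonnegativity and symmetry of \<open>d\<close> outside the carrier; this is no
  restriction, since only the values of \<open>d\<close> on the carrier enter \<open>asdim\<close>.\<close>

definition proper_left_invariant_metric ::
    "('a, 'b) monoid_scheme \<Rightarrow> ('a \<Rightarrow> 'a \<Rightarrow> real) \<Rightarrow> bool" where
  "proper_left_invariant_metric G d \<longleftrightarrow>
     Metric_space (carrier G) d \<and>
     (\<forall>g\<in>carrier G. \<forall>x\<in>carrier G. \<forall>y\<in>carrier G. d (g \<otimes>\<^bsub>G\<^esub> x) (g \<otimes>\<^bsub>G\<^esub> y) = d x y) \<and>
     (\<forall>x\<in>carrier G. \<forall>r. finite (Metric_space.mcball (carrier G) d x r))"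

text \<open>Only meaningful for countable groups. Lemma \<open>countable_group_asdim_eq\<close> below shows that the
  value does not depend on the chosen metric; \<open>ex_proper_left_invariant_metric\<close> provides a metric
  when the group is finitely generated, the only case used in \<open>group_asdim\<close>.\<close>

definition countable_group_asdim :: "('a, 'b) monoid_scheme \<Rightarrow> enat" where
  "countable_group_asdim G = asdim (carrier G) (SOME d. proper_left_invariant_metric G d)"

definition group_asdim :: "('a, 'b) monoid_scheme \<Rightarrow> enat" where
  "group_asdim G =
     (SUP S\<in>{S. finite S \<and> S \<subseteq> carrier G}. countable_group_asdim (subgroup_generated G S))"

lemma proper_left_invariant_metric_control:
  assumes G: "group G"
    and d: "proper_left_invariant_metric G d" and e: "proper_left_invariant_metric G e"
  shows "\<exists>R'. \<forall>x\<in>carrier G. \<forall>y\<in>carrier G. d x y \<le> R \<longrightarrow> e x y \<le> R'"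
proof -
  interpret group G by fact
  interpret D: Metric_space "carrier G" d
    using d by (simp add: proper_left_invariant_metric_def)
  let ?B = "D.mcball \<one>\<^bsub>G\<^esub> R"
  have fin: "finite ?B"
    using d by (simp add: proper_left_invariant_metric_def)
  have shift: "f x y = f \<one>\<^bsub>G\<^esub> (inv\<^bsub>G\<^esub> x \<otimes>\<^bsub>G\<^esub> y)"
    if "proper_left_invariant_metric G f" "x \<in> carrier G" "y \<in> carrier G" for f x y
  proof -
    have "f (inv\<^bsub>G\<^esub> x \<otimes>\<^bsub>G\<^esub> x) (inv\<^bsub>G\<^esub> x \<otimes>\<^bsub>G\<^esub> y) = f x y"
      using that unfolding proper_left_invariant_metric_def by blast
    then show ?thesis using that by simp
  qed
  show ?thesis
  proof (intro exI ballI impI)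
    fix x y assume xy: "x \<in> carrier G" "y \<in> carrier G" "d x y \<le> R"
    have "inv\<^bsub>G\<^esub> x \<otimes>\<^bsub>G\<^esub> y \<in> ?B"
      using xy shift[OF d xy(1,2)] by simp
    then show "e x y \<le> Max (insert 0 (e \<one>\<^bsub>G\<^esub> ` ?B))"
      using shift[OF e xy(1,2)] fin by simp
  qed
qed

lemma asdim_le_transfer:
  assumes G: "group G"
    and d: "proper_left_invariant_metric G d" and e: "proper_left_invariant_metric G e"
    and le: "asdim_le (carrier G) d n"
  shows "asdim_le (carrier G) e n"
  unfolding asdim_le_def
proof (intro allI impI)
  fix r :: real assume "r > 0"
  obtain s where s: "\<And>x y. x \<in> carrier G \<Longrightarrow> y \<in> carrier G \<Longrightarrow> e x y \<le> r \<Longrightarrow> d x y \<le> s"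
    using proper_left_invariant_metric_control[OF G e d] by blast
  have "max s 1 > 0" by simp
  then obtain R \<U> where U: "(\<Union>i\<le>n. \<Union> (\<U> i)) = carrier G"
    "\<And>i. i \<le> n \<Longrightarrow> bounded_family d R (\<U> i)"
    "\<And>i. i \<le> n \<Longrightarrow> disjoint_family_at_scale d (max s 1) (\<U> i)"
    using le unfolding asdim_le_def by meson
  obtain R' where R': "\<And>x y. x \<in> carrier G \<Longrightarrow> y \<in> carrier G \<Longrightarrow> d x y \<le> R \<Longrightarrow> e x y \<le> R'"
    using proper_left_invariant_metric_control[OF G d e] by blast
  have sub: "x \<in> carrier G" if "i \<le> n" "A \<in> \<U> i" "x \<in> A" for i A x
    using U(1) that by blast
  have "bounded_family e R' (\<U> i)" if i: "i \<le> n" for i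
    unfolding bounded_family_def
  proof (intro ballI)
    fix A x y assume *: "A \<in> \<U> i" "x \<in> A" "y \<in> A"
    then have "d x y \<le> R"
      using U(2)[OF i] unfolding bounded_family_def by simp
    then show "e x y \<le> R'"
      using * by (intro R' sub[OF i])
  qed
  moreover have "disjoint_family_at_scale e r (\<U> i)" if i: "i \<le> n" for i
    unfolding disjoint_family_at_scale_def
  proof (intro ballI impI)
    fix A B x y assume *: "A \<in> \<U> i" "B \<in> \<U> i" "A \<noteq> B" "x \<in> A" "y \<in> B"
    then have "d x y > max s 1"
      using U(3)[OF i] unfolding disjoint_family_at_scale_def by blast
    then show "e x y > r"
      using s[OF sub[OF i *(1,4)] sub[OF i *(2,5)]] by linarith
  qed
  ultimately show "\<exists>R \<U>. (\<Union>i\<le>n. \<Union> (\<U> i)) = carrier G \<and>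
      (\<forall>i\<le>n. bounded_family e R (\<U> i) \<and> disjoint_family_at_scale e r (\<U> i))"
    using U(1) by blast
qed

lemma countable_group_asdim_eq:
  assumes "group G" "proper_left_invariant_metric G d"
  shows "countable_group_asdim G = asdim (carrier G) d"
proof -
  have "proper_left_invariant_metric G (SOME d. proper_left_invariant_metric G d)"
    by (rule someI[where P = "proper_left_invariant_metric G", OF assms(2)])
  then have "asdim_le (carrier G) (SOME d. proper_left_invariant_metric G d) n \<longleftrightarrow>
      asdim_le (carrier G) d n" for n
    using asdim_le_transfer[OF assms(1)] assms(2) by blast
  then show ?thesis
    unfolding countable_group_asdim_def asdim_def by simp
qed

lemma ex_proper_left_invariant_metric:
  assumes G: "group G" and S: "finite S" "S \<subseteq> carrier G" and gen: "carrier G = generate G S"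
  shows "\<exists>d. proper_left_invariant_metric G d"
proof -
  interpret group G by fact
  have cancel: "a \<otimes>\<^bsub>G\<^esub> (inv\<^bsub>G\<^esub> a \<otimes>\<^bsub>G\<^esub> b) = b" "inv\<^bsub>G\<^esub> a \<otimes>\<^bsub>G\<^esub> (a \<otimes>\<^bsub>G\<^esub> b) = b"
    if "a \<in> carrier G" "b \<in> carrier G" for a b
    using that by (simp_all flip: m_assoc)
  define T where "T = S \<union> m_inv G ` S"
  have T: "finite T" "T \<subseteq> carrier G" using S by (auto simp: T_def)
  have Tinv: "inv\<^bsub>G\<^esub> t \<in> T" if "t \<in> T" for t using that S by (force simp: T_def)
  define W where "W n = {foldr (\<otimes>\<^bsub>G\<^esub>) ws \<one>\<^bsub>G\<^esub> |ws. set ws \<subseteq> T \<and> length ws = n}" for n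
  have W_carr: "W n \<subseteq> carrier G" for n
  proof -
    have "foldr (\<otimes>\<^bsub>G\<^esub>) ws \<one>\<^bsub>G\<^esub> \<in> carrier G" if "set ws \<subseteq> T" for ws
      using that T by (induction ws) auto
    then show ?thesis by (auto simp: W_def)
  qed
  have W_fin: "finite (W n)" for n
  proof -
    have "W n = (\<lambda>ws. foldr (\<otimes>\<^bsub>G\<^esub>) ws \<one>\<^bsub>G\<^esub>) ` {ws. set ws \<subseteq> T \<and> length ws = n}"
      by (auto simp: W_def)
    then show ?thesis using finite_lists_length_eq[OF T(1)] by simp
  qed
  have W_0: "W 0 = {\<one>\<^bsub>G\<^esub>}" by (auto simp: W_def)
  have W_Suc: "t \<otimes>\<^bsub>G\<^esub> x \<in> W (Suc n)" if "t \<in> T" "x \<in> W n" for t x n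
  proof -
    obtain ws where "set ws \<subseteq> T" "length ws = n" "x = foldr (\<otimes>\<^bsub>G\<^esub>) ws \<one>\<^bsub>G\<^esub>"
      using \<open>x \<in> W n\<close> by (auto simp: W_def)
    then show ?thesis using \<open>t \<in> T\<close> unfolding W_def by (intro CollectI exI[of _ "t # ws"]) auto
  qed
  have W_SucE: "\<exists>t\<in>T. \<exists>y\<in>W n. x = t \<otimes>\<^bsub>G\<^esub> y" if "x \<in> W (Suc n)" for x n
    using that unfolding W_def by (fastforce simp: length_Suc_conv)
  have W_mult: "x \<otimes>\<^bsub>G\<^esub> y \<in> W (m + n)" if "x \<in> W m" "y \<in> W n" for x y m n
    using that
  proof (induction m arbitrary: x)
    case 0 then show ?case using W_0 W_carr[of n] by auto
  next
    case (Suc m)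
    then obtain t z where tz: "t \<in> T" "z \<in> W m" "x = t \<otimes>\<^bsub>G\<^esub> z" using W_SucE by blast
    then have "x \<otimes>\<^bsub>G\<^esub> y = t \<otimes>\<^bsub>G\<^esub> (z \<otimes>\<^bsub>G\<^esub> y)" using T W_carr Suc.prems by (simp add: m_assoc subset_eq)
    then show ?case using W_Suc[OF tz(1) Suc.IH[OF tz(2) Suc.prems(2)]] by simp
  qed
  have W_1: "t \<in> W 1" if "t \<in> T" for t
    using W_Suc[OF that, of "\<one>\<^bsub>G\<^esub>" 0] W_0 T that by (simp add: subset_eq)
  have W_inv: "inv\<^bsub>G\<^esub> x \<in> W n" if "x \<in> W n" for x n
    using that
  proof (induction n arbitrary: x)
    case 0 then show ?case using W_0 by auto
  next
    case (Suc n)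
    then obtain t z where tz: "t \<in> T" "z \<in> W n" "x = t \<otimes>\<^bsub>G\<^esub> z" using W_SucE by blast
    then have "inv\<^bsub>G\<^esub> x = inv\<^bsub>G\<^esub> z \<otimes>\<^bsub>G\<^esub> inv\<^bsub>G\<^esub> t" using T W_carr by (simp add: inv_mult_group subset_eq)
    then show ?case using W_mult[OF Suc.IH[OF tz(2)] W_1[OF Tinv[OF tz(1)]]] by simp
  qed
  have ex: "\<exists>n. x \<in> W n" if "x \<in> carrier G" for x
    using that unfolding gen
  proof (induction rule: generate.induct)
    case one then show ?case using W_0 by auto
  next
    case (incl h) then show ?case using W_1 by (auto simp: T_def)
  next
    case (inv h) then show ?case using W_1 by (auto simp: T_def)
  next
    case (eng h1 h2) then show ?case using W_mult by blast
  qed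
  define l where "l x = (LEAST n. x \<in> W n)" for x
  have l_W: "x \<in> W (l x)" if "x \<in> carrier G" for x
    unfolding l_def using ex[OF that] by (rule LeastI_ex)
  have l_le: "l x \<le> n" if "x \<in> W n" for x n
    unfolding l_def using that by (rule Least_le)
  have l_inv: "l (inv\<^bsub>G\<^esub> x) = l x" if "x \<in> carrier G" for x
    using l_le[OF W_inv[OF l_W[OF that]]] l_le[OF W_inv[OF l_W[of "inv\<^bsub>G\<^esub> x"]]] that by simp
  define d where "d x y =
    (if x \<in> carrier G \<and> y \<in> carrier G then real (l (inv\<^bsub>G\<^esub> x \<otimes>\<^bsub>G\<^esub> y)) else 0)" for x y
  interpret D: Metric_space "carrier G" d
  proof
    fix x y show "0 \<le> d x y" by (simp add: d_def)
    show "d x y = d y x"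
      using l_inv[of "inv\<^bsub>G\<^esub> x \<otimes>\<^bsub>G\<^esub> y"]
      by (cases "x \<in> carrier G \<and> y \<in> carrier G") (auto simp: d_def inv_mult_group)
  next
    fix x y assume xy: "x \<in> carrier G" "y \<in> carrier G"
    show "d x y = 0 \<longleftrightarrow> x = y"
    proof
      assume "d x y = 0"
      then have "inv\<^bsub>G\<^esub> x \<otimes>\<^bsub>G\<^esub> y = \<one>\<^bsub>G\<^esub>" using l_W[of "inv\<^bsub>G\<^esub> x \<otimes>\<^bsub>G\<^esub> y"] xy W_0 by (simp add: d_def)
      then show "x = y" using xy by (metis inv_equality inv_inv inv_closed)
    next
      assume "x = y"
      then show "d x y = 0" using xy l_le[of "\<one>\<^bsub>G\<^esub>" 0] W_0 by (simp add: d_def)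
    qed
  next
    fix x y z assume xyz: "x \<in> carrier G" "y \<in> carrier G" "z \<in> carrier G"
    have "(inv\<^bsub>G\<^esub> x \<otimes>\<^bsub>G\<^esub> y) \<otimes>\<^bsub>G\<^esub> (inv\<^bsub>G\<^esub> y \<otimes>\<^bsub>G\<^esub> z) = inv\<^bsub>G\<^esub> x \<otimes>\<^bsub>G\<^esub> z"
      using xyz by (simp add: m_assoc cancel)
    then have "l (inv\<^bsub>G\<^esub> x \<otimes>\<^bsub>G\<^esub> z) \<le> l (inv\<^bsub>G\<^esub> x \<otimes>\<^bsub>G\<^esub> y) + l (inv\<^bsub>G\<^esub> y \<otimes>\<^bsub>G\<^esub> z)"
      using l_le[OF W_mult[OF l_W l_W]] xyz by (metis inv_closed m_closed)
    then show "d x z \<le> d x y + d y z" using xyz by (simp add: d_def)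
  qed
  have "d (g \<otimes>\<^bsub>G\<^esub> x) (g \<otimes>\<^bsub>G\<^esub> y) = d x y"
    if "g \<in> carrier G" "x \<in> carrier G" "y \<in> carrier G" for g x y
  proof -
    have "inv\<^bsub>G\<^esub> (g \<otimes>\<^bsub>G\<^esub> x) \<otimes>\<^bsub>G\<^esub> (g \<otimes>\<^bsub>G\<^esub> y) = inv\<^bsub>G\<^esub> x \<otimes>\<^bsub>G\<^esub> y"
      using that by (simp add: inv_mult_group m_assoc cancel)
    then show ?thesis using that by (simp add: d_def)
  qed
  moreover have "finite (D.mcball x r)" if x: "x \<in> carrier G" for x r
  proof (rule finite_subset)
    show "D.mcball x r \<subseteq> (\<lambda>z. x \<otimes>\<^bsub>G\<^esub> z) ` (\<Union>n\<le>nat \<lfloor>r\<rfloor>. W n)"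
    proof
      fix y assume y: "y \<in> D.mcball x r"
      let ?z = "inv\<^bsub>G\<^esub> x \<otimes>\<^bsub>G\<^esub> y"
      have "?z \<in> W (l ?z)" "l ?z \<le> nat \<lfloor>r\<rfloor>"
        using y x l_W[of ?z] by (auto simp: d_def le_nat_floor)
      moreover have "y = x \<otimes>\<^bsub>G\<^esub> ?z" using x y by (simp add: cancel)
      ultimately show "y \<in> (\<lambda>z. x \<otimes>\<^bsub>G\<^esub> z) ` (\<Union>n\<le>nat \<lfloor>r\<rfloor>. W n)" by blast
    qed
  qed (use W_fin in auto)
  ultimately show ?thesis
    unfolding proper_left_invariant_metric_def using D.Metric_space_axioms by blast
qed


section \<open>The rational vector space \<open>A \<otimes>\<^sub>\<int> \<rat>\<close>\<close>

text \<open>For a commutative group \<open>A\<close> (written multiplicatively), \<open>A \<otimes> \<rat>\<close> is the free abelian group on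
  \<open>A \<times> \<rat>\<close> modulo the subgroup generated by the biadditivity relations; the class of
  \<open>frag_of (a, q)\<close> is the elementary tensor \<open>a \<otimes> q\<close>.\<close>

definition rat_tensor_free :: "('a, 'b) monoid_scheme \<Rightarrow> ('a \<times> rat \<Rightarrow>\<^sub>0 int) monoid" where
  "rat_tensor_free A = free_Abelian_group (carrier A \<times> UNIV)"

definition rat_tensor_rels :: "('a, 'b) monoid_scheme \<Rightarrow> ('a \<times> rat \<Rightarrow>\<^sub>0 int) set" where
  "rat_tensor_rels A =
     {frag_of (a \<otimes>\<^bsub>A\<^esub> b, q) - frag_of (a, q) - frag_of (b, q) |a b q.
        a \<in> carrier A \<and> b \<in> carrier A} \<union>
     {frag_of (a, p + q) - frag_of (a, p) - frag_of (a, q) |a p q. a \<in> carrier A}"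

definition rat_tensor_kernel :: "('a, 'b) monoid_scheme \<Rightarrow> ('a \<times> rat \<Rightarrow>\<^sub>0 int) set" where
  "rat_tensor_kernel A = generate (rat_tensor_free A) (rat_tensor_rels A)"

text \<open>The action of \<open>q\<close> on \<open>A \<otimes> \<rat>\<close> is induced by \<open>(a, p) \<mapsto> (a, q * p)\<close>.\<close>

definition rat_tensor_scale :: "rat \<Rightarrow> ('a \<times> rat \<Rightarrow>\<^sub>0 int) \<Rightarrow> ('a \<times> rat \<Rightarrow>\<^sub>0 int)" where
  "rat_tensor_scale q = frag_extend (\<lambda>(a, p). frag_of (a, q * p))"

definition rat_tensor :: "('a, 'b) monoid_scheme \<Rightarrow> (rat, ('a \<times> rat \<Rightarrow>\<^sub>0 int) set) module" where
  "rat_tensor A =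
     (let T = rat_tensor_free A Mod rat_tensor_kernel A in
      \<lparr>carrier = carrier T, mult = undefined, one = undefined,
       zero = \<one>\<^bsub>T\<^esub>, add = (\<otimes>\<^bsub>T\<^esub>),
       smult = (\<lambda>q C. \<Union>x\<in>C. rat_tensor_kernel A #>\<^bsub>rat_tensor_free A\<^esub> rat_tensor_scale q x)\<rparr>)"

lemma keys_rat_tensor_scale:
  assumes "x \<in> carrier (rat_tensor_free A)"
  shows "rat_tensor_scale q x \<in> carrier (rat_tensor_free A)"
proof -
  have "Poly_Mapping.keys x \<subseteq> carrier A \<times> UNIV"
    using assms by (simp add: rat_tensor_free_def)
  then have "Poly_Mapping.keys (rat_tensor_scale q x) \<subseteq> carrier A \<times> UNIV"
  proof (rule free_Abelian_group_induct)
    fix x y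
    assume "Poly_Mapping.keys (rat_tensor_scale q x) \<subseteq> carrier A \<times> UNIV"
      "Poly_Mapping.keys (rat_tensor_scale q y) \<subseteq> carrier A \<times> UNIV"
    then show "Poly_Mapping.keys (rat_tensor_scale q (x - y)) \<subseteq> carrier A \<times> UNIV"
      using keys_diff[of "rat_tensor_scale q x" "rat_tensor_scale q y"]
      by (fastforce simp: rat_tensor_scale_def frag_extend_diff)
  qed (auto simp: rat_tensor_scale_def)
  then show ?thesis by (simp add: rat_tensor_free_def)
qed

lemma rat_tensor_rels_carrier:
  assumes "group A"
  shows "rat_tensor_rels A \<subseteq> carrier (rat_tensor_free A)"
proof -
  interpret group A by fact
  have *: "Poly_Mapping.keys (frag_of u - frag_of v - frag_of w) \<subseteq> {u, v, w}"
    for u v w :: "'a \<times> rat"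
    using keys_diff[of "frag_of u - frag_of v" "frag_of w"] keys_diff[of "frag_of u" "frag_of v"]
    by auto
  show ?thesis
    unfolding rat_tensor_rels_def rat_tensor_free_def
    by (auto dest!: subsetD[OF *])
qed

lemma rat_tensor_kernel_subgroup:
  assumes "group A"
  shows "subgroup (rat_tensor_kernel A) (rat_tensor_free A)"
  unfolding rat_tensor_kernel_def
  by (rule group.generate_is_subgroup)
    (use rat_tensor_rels_carrier[OF assms] in \<open>auto simp: rat_tensor_free_def\<close>)

lemma rat_tensor_kernel_normal:
  assumes "group A"
  shows "rat_tensor_kernel A \<lhd> rat_tensor_free A"
  using comm_group.normal_iff_subgroup rat_tensor_kernel_subgroup[OF assms]
    abelian_free_Abelian_group unfolding rat_tensor_free_def by metis

lemma rat_tensor_scale_kernel: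
  assumes A: "group A" and x: "x \<in> rat_tensor_kernel A"
  shows "rat_tensor_scale q x \<in> rat_tensor_kernel A"
proof -
  interpret K: subgroup "rat_tensor_kernel A" "rat_tensor_free A"
    by (rule rat_tensor_kernel_subgroup[OF A])
  have rel: "rat_tensor_scale q h \<in> rat_tensor_rels A" if "h \<in> rat_tensor_rels A" for h
    using that unfolding rat_tensor_rels_def rat_tensor_scale_def
    by (fastforce simp: frag_extend_diff distrib_left)
  have incl: "h \<in> rat_tensor_kernel A" if "h \<in> rat_tensor_rels A" for h
    unfolding rat_tensor_kernel_def using that by (rule generate.incl)
  from x show ?thesis
    unfolding rat_tensor_kernel_def[of A]
  proof (induction rule: generate.induct)
    case one
    then show ?case
      using K.one_closed by (simp add: rat_tensor_scale_def rat_tensor_free_def rat_tensor_kernel_def)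
  next
    case (incl h)
    then show ?case using rel generate.incl by metis
  next
    case (inv h)
    then have h: "h \<in> carrier (rat_tensor_free A)" using rat_tensor_rels_carrier[OF A] by blast
    have "inv\<^bsub>rat_tensor_free A\<^esub> rat_tensor_scale q h =
        rat_tensor_scale q (inv\<^bsub>rat_tensor_free A\<^esub> h)"
      using h keys_rat_tensor_scale[OF h]
      by (simp add: rat_tensor_free_def rat_tensor_scale_def frag_extend_minus)
    then show ?case using generate.inv[OF rel[OF inv], of "rat_tensor_free A"] by simp
  next
    case (eng h1 h2)
    have "rat_tensor_scale q (h1 \<otimes>\<^bsub>rat_tensor_free A\<^esub> h2) =
      rat_tensor_scale q h1 \<otimes>\<^bsub>rat_tensor_free A\<^esub> rat_tensor_scale q h2"
      by (simp add: rat_tensor_free_def rat_tensor_scale_def frag_extend_add)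
    then show ?case using generate.eng[OF eng.IH] by simp
  qed
qed

lemma rat_tensor_simps:
  "carrier (rat_tensor A) = carrier (rat_tensor_free A Mod rat_tensor_kernel A)"
  "\<zero>\<^bsub>rat_tensor A\<^esub> = \<one>\<^bsub>rat_tensor_free A Mod rat_tensor_kernel A\<^esub>"
  "C \<oplus>\<^bsub>rat_tensor A\<^esub> D = C \<otimes>\<^bsub>rat_tensor_free A Mod rat_tensor_kernel A\<^esub> D"
  "q \<odot>\<^bsub>rat_tensor A\<^esub> C =
     (\<Union>x\<in>C. rat_tensor_kernel A #>\<^bsub>rat_tensor_free A\<^esub> rat_tensor_scale q x)"
  by (simp_all add: rat_tensor_def Let_def)

lemma rat_tensor_add_coset:
  assumes A: "group A"
    and x: "x \<in> carrier (rat_tensor_free A)" and y: "y \<in> carrier (rat_tensor_free A)"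
  shows "(rat_tensor_kernel A #>\<^bsub>rat_tensor_free A\<^esub> x) \<oplus>\<^bsub>rat_tensor A\<^esub>
      (rat_tensor_kernel A #>\<^bsub>rat_tensor_free A\<^esub> y) =
    rat_tensor_kernel A #>\<^bsub>rat_tensor_free A\<^esub> (x + y)"
  using normal.rcos_sum[OF rat_tensor_kernel_normal[OF A] x y]
  by (simp add: rat_tensor_simps rat_tensor_free_def)

lemma rat_tensor_smult_coset:
  assumes A: "group A" and x: "x \<in> carrier (rat_tensor_free A)"
  shows "q \<odot>\<^bsub>rat_tensor A\<^esub> (rat_tensor_kernel A #>\<^bsub>rat_tensor_free A\<^esub> x) =
    rat_tensor_kernel A #>\<^bsub>rat_tensor_free A\<^esub> rat_tensor_scale q x"
proof -
  let ?F = "rat_tensor_free A" and ?N = "rat_tensor_kernel A"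
  interpret F: group ?F by (simp add: rat_tensor_free_def)
  interpret N: subgroup ?N ?F by (rule rat_tensor_kernel_subgroup[OF A])
  have "?N #>\<^bsub>?F\<^esub> rat_tensor_scale q y = ?N #>\<^bsub>?F\<^esub> rat_tensor_scale q x"
    if y: "y \<in> ?N #>\<^bsub>?F\<^esub> x" for y
  proof -
    obtain k where k: "k \<in> ?N" "y = k + x"
      using y by (auto simp: r_coset_def rat_tensor_free_def)
    have "rat_tensor_scale q y = rat_tensor_scale q k \<otimes>\<^bsub>?F\<^esub> rat_tensor_scale q x"
      by (simp add: k rat_tensor_scale_def rat_tensor_free_def frag_extend_add)
    then have "rat_tensor_scale q y \<in> ?N #>\<^bsub>?F\<^esub> rat_tensor_scale q x"
      using rat_tensor_scale_kernel[OF A k(1)] by (auto simp: r_coset_def)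
    then show ?thesis
      using F.repr_independence[OF _ keys_rat_tensor_scale[OF x] N.subgroup_axioms] by simp
  qed
  moreover have "x \<in> ?N #>\<^bsub>?F\<^esub> x"
    using F.rcos_self[OF x N.subgroup_axioms] .
  ultimately show ?thesis unfolding rat_tensor_simps(4) by blast
qed

lemma rat_tensor_cosetE:
  assumes "C \<in> carrier (rat_tensor A)"
  obtains x where "x \<in> carrier (rat_tensor_free A)"
    "C = rat_tensor_kernel A #>\<^bsub>rat_tensor_free A\<^esub> x"
  using assms by (auto simp: rat_tensor_simps FactGroup_def RCOSETS_def)

lemma rat_tensor_scale_add_left:
  assumes A: "group A" and x: "x \<in> carrier (rat_tensor_free A)"
  shows "rat_tensor_scale (p + q) x - (rat_tensor_scale p x + rat_tensor_scale q x)
    \<in> rat_tensor_kernel A" (is "?D x \<in> _")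
proof -
  interpret N: subgroup "rat_tensor_kernel A" "rat_tensor_free A"
    by (rule rat_tensor_kernel_subgroup[OF A])
  have "Poly_Mapping.keys x \<subseteq> carrier A \<times> UNIV"
    using x by (simp add: rat_tensor_free_def)
  then show ?thesis
  proof (rule free_Abelian_group_induct)
    show "?D 0 \<in> rat_tensor_kernel A"
      using N.one_closed by (simp add: rat_tensor_scale_def rat_tensor_free_def)
  next
    fix x y assume xy: "?D x \<in> rat_tensor_kernel A" "?D y \<in> rat_tensor_kernel A"
    then have "?D x \<otimes>\<^bsub>rat_tensor_free A\<^esub> inv\<^bsub>rat_tensor_free A\<^esub> ?D y \<in> rat_tensor_kernel A"
      by blast
    moreover have "a \<otimes>\<^bsub>rat_tensor_free A\<^esub> inv\<^bsub>rat_tensor_free A\<^esub> b = a - b"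
      if "b \<in> carrier (rat_tensor_free A)" for a b
      using that by (simp add: rat_tensor_free_def)
    moreover have "?D (x - y) = ?D x - ?D y"
      by (simp add: rat_tensor_scale_def frag_extend_diff)
    ultimately show "?D (x - y) \<in> rat_tensor_kernel A"
      using N.mem_carrier[OF xy(2)] by simp
  next
    fix u assume "u \<in> carrier A \<times> (UNIV :: rat set)"
    then obtain a r where u: "u = (a, r)" "a \<in> carrier A" by blast
    have "frag_of (a, p * r + q * r) - frag_of (a, p * r) - frag_of (a, q * r) \<in> rat_tensor_rels A"
      using u unfolding rat_tensor_rels_def by blast
    then show "?D (frag_of u) \<in> rat_tensor_kernel A"
      unfolding rat_tensor_kernel_def
      by (intro generate.incl) (simp add: u rat_tensor_scale_def distrib_right diff_diff_eq)
  qed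
qed

lemma vectorspace_rat_tensor:
  assumes A: "group A"
  shows "vectorspace (class_ring :: rat ring) (rat_tensor A)"
proof -
  let ?F = "rat_tensor_free A" and ?N = "rat_tensor_kernel A" and ?K = "class_ring :: rat ring"
  interpret F: comm_group ?F by (simp add: rat_tensor_free_def abelian_free_Abelian_group)
  interpret N: normal ?N ?F by (rule rat_tensor_kernel_normal[OF A])
  have coset: "?N #>\<^bsub>?F\<^esub> x \<in> carrier (rat_tensor A)" if "x \<in> carrier ?F" for x
    using that by (auto simp: rat_tensor_simps FactGroup_def RCOSETS_def)
  have add_closed: "x + y \<in> carrier ?F" if "x \<in> carrier ?F" "y \<in> carrier ?F" for x y
    using F.m_closed[OF that] by (simp add: rat_tensor_free_def)
  have scale_add: "rat_tensor_scale q (x + y) = rat_tensor_scale q x + rat_tensor_scale q y" for q x y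
    by (simp add: rat_tensor_scale_def frag_extend_add)
  note [simp] = rat_tensor_add_coset[OF A] rat_tensor_smult_coset[OF A] keys_rat_tensor_scale coset
    add_closed
  have zero: "\<zero>\<^bsub>rat_tensor A\<^esub> = ?N #>\<^bsub>?F\<^esub> 0"
    using F.coset_mult_one[OF N.subset] by (simp add: rat_tensor_simps rat_tensor_free_def)
  have zero_F: "0 \<in> carrier ?F" by (simp add: rat_tensor_free_def)
  have neg_F: "- x \<in> carrier ?F" if "x \<in> carrier ?F" for x
    using that by (simp add: rat_tensor_free_def)
  have ab: "abelian_group (rat_tensor A)"
  proof (rule abelian_groupI)
    fix C D assume "C \<in> carrier (rat_tensor A)" "D \<in> carrier (rat_tensor A)"
    then show "C \<oplus>\<^bsub>rat_tensor A\<^esub> D \<in> carrier (rat_tensor A)"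
      by (elim rat_tensor_cosetE) simp
  next
    show "\<zero>\<^bsub>rat_tensor A\<^esub> \<in> carrier (rat_tensor A)" using zero_F by (simp add: zero)
  next
    fix C D E
    assume "C \<in> carrier (rat_tensor A)" "D \<in> carrier (rat_tensor A)" "E \<in> carrier (rat_tensor A)"
    then show "C \<oplus>\<^bsub>rat_tensor A\<^esub> D \<oplus>\<^bsub>rat_tensor A\<^esub> E =
        C \<oplus>\<^bsub>rat_tensor A\<^esub> (D \<oplus>\<^bsub>rat_tensor A\<^esub> E)"
      by (elim rat_tensor_cosetE) (simp add: add.assoc)
  next
    fix C D assume "C \<in> carrier (rat_tensor A)" "D \<in> carrier (rat_tensor A)"
    then show "C \<oplus>\<^bsub>rat_tensor A\<^esub> D = D \<oplus>\<^bsub>rat_tensor A\<^esub> C"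
      by (elim rat_tensor_cosetE) (simp add: add.commute)
  next
    fix C assume "C \<in> carrier (rat_tensor A)"
    then show "\<zero>\<^bsub>rat_tensor A\<^esub> \<oplus>\<^bsub>rat_tensor A\<^esub> C = C"
      using zero_F by (elim rat_tensor_cosetE) (simp add: zero)
  next
    fix C assume "C \<in> carrier (rat_tensor A)"
    then obtain x where x: "x \<in> carrier ?F" "C = ?N #>\<^bsub>?F\<^esub> x" by (rule rat_tensor_cosetE)
    show "\<exists>D\<in>carrier (rat_tensor A). D \<oplus>\<^bsub>rat_tensor A\<^esub> C = \<zero>\<^bsub>rat_tensor A\<^esub>"
      using x neg_F[OF x(1)] by (intro bexI[of _ "?N #>\<^bsub>?F\<^esub> (- x)"]) (simp_all add: zero)
  qed
  have "Module.module ?K (rat_tensor A)"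
  proof (rule moduleI)
    show "cring ?K" using class_field fieldE(1) by blast
    show "abelian_group (rat_tensor A)" by (rule ab)
  next
    fix q C assume "C \<in> carrier (rat_tensor A)"
    then show "q \<odot>\<^bsub>rat_tensor A\<^esub> C \<in> carrier (rat_tensor A)"
      by (elim rat_tensor_cosetE) simp
  next
    fix p q C assume "C \<in> carrier (rat_tensor A)"
    then obtain x where x: "x \<in> carrier ?F" "C = ?N #>\<^bsub>?F\<^esub> x" by (rule rat_tensor_cosetE)
    let ?u = "rat_tensor_scale p x + rat_tensor_scale q x"
    let ?v = "rat_tensor_scale (p + q) x"
    have "?v = (?v - ?u) \<otimes>\<^bsub>?F\<^esub> ?u" by (simp add: rat_tensor_free_def)
    then have "?v \<in> ?N #>\<^bsub>?F\<^esub> ?u"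
      using rat_tensor_scale_add_left[OF A x(1)] unfolding r_coset_def by blast
    then have "?N #>\<^bsub>?F\<^esub> ?u = ?N #>\<^bsub>?F\<^esub> ?v"
      by (rule F.repr_independence) (use x N.subgroup_axioms in simp_all)
    then show "(p \<oplus>\<^bsub>?K\<^esub> q) \<odot>\<^bsub>rat_tensor A\<^esub> C =
        p \<odot>\<^bsub>rat_tensor A\<^esub> C \<oplus>\<^bsub>rat_tensor A\<^esub> q \<odot>\<^bsub>rat_tensor A\<^esub> C"
      using x by simp
  next
    fix q C D assume "C \<in> carrier (rat_tensor A)" "D \<in> carrier (rat_tensor A)"
    then show "q \<odot>\<^bsub>rat_tensor A\<^esub> (C \<oplus>\<^bsub>rat_tensor A\<^esub> D) =
        q \<odot>\<^bsub>rat_tensor A\<^esub> C \<oplus>\<^bsub>rat_tensor A\<^esub> q \<odot>\<^bsub>rat_tensor A\<^esub> D"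
      by (elim rat_tensor_cosetE) (simp add: scale_add)
  next
    have comp: "rat_tensor_scale (p * q) x = rat_tensor_scale p (rat_tensor_scale q x)"
      for p q and x :: "'a \<times> rat \<Rightarrow>\<^sub>0 int"
      by (rule free_Abelian_group_induct[of x UNIV])
         (auto simp: rat_tensor_scale_def frag_extend_diff mult.assoc)
    fix p q C assume "C \<in> carrier (rat_tensor A)"
    then show "(p \<otimes>\<^bsub>?K\<^esub> q) \<odot>\<^bsub>rat_tensor A\<^esub> C = p \<odot>\<^bsub>rat_tensor A\<^esub> (q \<odot>\<^bsub>rat_tensor A\<^esub> C)"
      by (elim rat_tensor_cosetE) (simp add: comp)
  next
    have id: "rat_tensor_scale 1 x = x" for x :: "'a \<times> rat \<Rightarrow>\<^sub>0 int"
      by (rule free_Abelian_group_induct[of x UNIV])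
         (auto simp: rat_tensor_scale_def frag_extend_diff)
    fix C assume "C \<in> carrier (rat_tensor A)"
    then show "\<one>\<^bsub>?K\<^esub> \<odot>\<^bsub>rat_tensor A\<^esub> C = C"
      by (elim rat_tensor_cosetE) (simp add: id)
  qed
  then show ?thesis
    using class_field by (intro vectorspace.intro)
qed

text \<open>\<open>vectorspace.dim\<close> is natural-number valued and arbitrary in the infinite-dimensional case.\<close>

definition vdim :: "('k, 'c) ring_scheme \<Rightarrow> ('k, 'v, 'd) module_scheme \<Rightarrow> enat" where
  "vdim K V = (if vectorspace.fin_dim K V then enat (vectorspace.dim K V) else \<infinity>)"


section \<open>Hirsch length\<close>

definition derived_series :: "('a, 'b) monoid_scheme \<Rightarrow> nat \<Rightarrow> 'a set" where
  "derived_series G i = (derived G ^^ i) (carrier G)"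

definition derived_length :: "('a, 'b) monoid_scheme \<Rightarrow> nat" where
  "derived_length G = (LEAST n. derived_series G n = {\<one>\<^bsub>G\<^esub>})"

text \<open>\<open>derived_series\<close> is indexed downwards from \<open>G\<close>, so its \<open>i\<close>-th term is \<open>G\<^sub>n\<^sub>-\<^sub>i\<close> of the ascending
  series \<open>1 = G\<^sub>0 \<subseteq> \<dots> \<subseteq> G\<^sub>n = G\<close>.\<close>

definition hirsch_length :: "('a, 'b) monoid_scheme \<Rightarrow> enat" where
  "hirsch_length G =
     (\<Sum>i<derived_length G.
        vdim (class_ring :: rat ring)
          (rat_tensor (G\<lparr>carrier := derived_series G i\<rparr> Mod derived_series G (Suc i))))"

end

theory Submission
  imports Defs "HOL-Algebra.Multiplicative_Group"
begin

text \<open>Asymptotic dimension depends on a metric only through its coarse structure, that is, through the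
  relations of bounded distance. For a group with a proper left invariant metric these are the relations
  with finitely many differences \<open>x\<inverse> y\<close>, a description that involves no metric and makes sense for
  arbitrary groups. With respect to this coarse structure the dimension of a group bounds that of its
  subgroups (\<open>group_coarse_asdim_le_subgroup\<close>), and for finitely generated groups it bounds the metric
  dimension (\<open>coarse_asdim_imp_asdim_le\<close>). Hence it suffices to bound the coarse dimension of the
  solvable group \<open>G\<close> itself.

  The main tool is the inequality \<open>asdim G \<le> asdim K + asdim Q\<close> for an extension of \<open>Q\<close> by \<open>K\<close>
  (\<open>asdim_extension\<close>), a special case of a Hurewicz type theorem for maps of coarse spaces
  (\<open>coarse_hurewicz\<close>). If \<open>K\<close> and \<open>Q\<close> have dimensions \<open>n\<close> and \<open>m\<close>, pairing the \<open>n + 1\<close> sets of a cover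
  along the fibres with the \<open>m + 1\<close> sets of a cover of the base would give \<open>(n + 1) (m + 1)\<close> sets,
  which is too many. Instead both covers are first enlarged to \<open>n + m + 1\<close> sets, so that each point
  lies in at least \<open>m + 1\<close> of the former and in at least \<open>n + 1\<close> of the latter
  (\<open>window_asdim_multiplicity\<close>). By counting, every point then lies in two sets with the same index, and
  only sets with equal index need to be intersected.

  By the extension inequality the dimension of \<open>G\<close> is at most the sum of the dimensions of the
  successive quotients of its derived series. These are abelian, and an abelian group \<open>A\<close> with
  \<open>r\<close>-dimensional \<open>A \<otimes> \<rat>\<close> has dimension at most \<open>r\<close> (\<open>asdim_le_rank\<close>): it contains a subgroup with at
  most \<open>r\<close> generators and torsion quotient (\<open>torsion_over_finite_generation\<close>). The subgroup is built from
  cyclic groups, each of dimension at most 1, and a torsion abelian group is locally finite and so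
  has dimension 0.\<close>

section \<open>Splitting a set into separated bounded pieces\<close>

text \<open>With \<open>E\<close> standing for nearness and \<open>F\<close> for a bound on distances, this describes a partition of \<open>X\<close>
  into bounded pieces that are far apart from each other. The partition is given by the function \<open>f\<close>
  naming the piece of each point: the pieces are the fibres of \<open>f\<close> on \<open>X\<close>.\<close>

definition labels :: "('a \<times> 'a) set \<Rightarrow> ('a \<times> 'a) set \<Rightarrow> 'a set \<Rightarrow> ('a \<Rightarrow> 'b) \<Rightarrow> bool" where
  "labels E F X f \<longleftrightarrow>
     (\<forall>x\<in>X. \<forall>y\<in>X. ((x, y) \<in> E \<longrightarrow> f x = f y) \<and> (f x = f y \<longrightarrow> (x, y) \<in> F))"

text \<open>An existential quantifier cannot range over the type of names. Sets of points are names enough,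
  since a piece can always be named by itself; this is what \<open>labels_imp_splits\<close> says.\<close>

definition splits :: "('a \<times> 'a) set \<Rightarrow> ('a \<times> 'a) set \<Rightarrow> 'a set \<Rightarrow> bool" where
  "splits E F X \<longleftrightarrow> (\<exists>f :: 'a \<Rightarrow> 'a set. labels E F X f)"

lemma labelsD:
  assumes "labels E F X f" "x \<in> X" "y \<in> X"
  shows "(x, y) \<in> E \<Longrightarrow> f x = f y" and "f x = f y \<Longrightarrow> (x, y) \<in> F"
  using assms by (simp_all add: labels_def)

lemma labels_imp_splits:
  assumes "labels E F X f"
  shows "splits E F X"
proof -
  have "{z \<in> X. f z = f x} = {z \<in> X. f z = f y} \<longleftrightarrow> f x = f y" if "x \<in> X" "y \<in> X" for x y
    using that by auto
  then show ?thesis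
    unfolding splits_def labels_def using assms
    by (intro exI[of _ "\<lambda>x. {z \<in> X. f z = f x}"]) (simp add: labels_def)
qed

lemma splitsI:
  assumes "\<And>x y. x \<in> X \<Longrightarrow> y \<in> X \<Longrightarrow> (x, y) \<in> E \<Longrightarrow> f x = f y"
    and "\<And>x y. x \<in> X \<Longrightarrow> y \<in> X \<Longrightarrow> f x = f y \<Longrightarrow> (x, y) \<in> F"
  shows "splits E F X"
  using assms by (intro labels_imp_splits[of _ _ _ f]) (simp add: labels_def)

lemma splits_mono:
  assumes "splits E F X" "Y \<subseteq> X" "E' \<subseteq> E" "F \<subseteq> F'"
  shows "splits E' F' Y"
  using assms unfolding splits_def labels_def by (meson subset_eq)

lemma splits_empty [simp]: "splits E F {}"
  by (simp add: splits_def labels_def)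

text \<open>Two split sets have a split union as soon as the separation of \<open>Y\<close> is coarser than the pieces
  of \<open>X\<close>. A piece of \<open>X\<close> that touches \<open>Y\<close> is absorbed into a piece of \<open>Y\<close> that it touches; two
  pieces of \<open>Y\<close> touched by the same piece of \<open>X\<close> would be related by \<open>E O F O E\<close>, so there is only
  one candidate. The pieces of \<open>X\<close> that touch nothing are kept.\<close>

lemma splits_Un:
  fixes X Y :: "'a set"
  assumes E: "sym E" and X: "splits E F X" and Y: "splits (E \<union> E O F O E) H Y"
  shows "splits E (F \<union> H \<union> F O E O H \<union> H O E O F \<union> F O E O H O E O F) (X \<union> Y)"
proof -
  obtain f :: "'a \<Rightarrow> 'a set" and g :: "'a \<Rightarrow> 'a set"
    where "labels E F X f" "labels (E \<union> E O F O E) H Y g"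
    using X Y unfolding splits_def by blast
  note f = labelsD[OF this(1)] and g = labelsD[OF this(2)]
  have sym: "(y, x) \<in> E" if "(x, y) \<in> E" for x y using E that by (rule symD)
  \<comment> \<open>\<open>near z y\<close>: the piece of \<open>z\<close> has to be absorbed by the piece of \<open>y\<close>\<close>
  define near where "near z y \<longleftrightarrow>
    y \<in> Y \<and> (z = y \<or> z \<notin> Y \<and> (\<exists>x\<in>X. f z = f x \<and> (x, y) \<in> E))" for z y
  have near_unique: "g y = g y'" if near: "near z y" "near z y'" for z y y'
  proof (cases "z \<in> Y")
    case True
    then show ?thesis using near by (auto simp: near_def)
  next
    case False
    then obtain u v where uv: "u \<in> X" "v \<in> X" "f u = f v" "(u, y) \<in> E" "(v, y') \<in> E" "y \<in> Y" "y' \<in> Y"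
      using near unfolding near_def by metis
    then have "(y, y') \<in> E O F O E" using f(2)[of u v] sym[of u y] by blast
    then show ?thesis using g(1)[of y y'] uv by blast
  qed
  define p where "p z = (SOME y. near z y)" for z
  define l where "l z = (if \<exists>y. near z y then Inl (g (p z)) else Inr (f z))" for z
  have near_p: "near z (p z)" if "near z y" for z y
    unfolding p_def using that by (rule someI)
  have l_near: "l z = Inl (g y)" if "near z y" for z y
  proof -
    have "l z = Inl (g (p z))" using that unfolding l_def by meson
    then show ?thesis using near_unique[OF near_p[OF that] that] by simp
  qed
  have l_cong: "l x = l y" if "x \<notin> Y" "y \<notin> Y" "f x = f y" for x y
  proof -
    have "near x = near y" using that by (auto simp: near_def fun_eq_iff)
    then show ?thesis using that by (simp add: l_def p_def)
  qed
  have near_FE: "z = y \<or> (z, y) \<in> F O E \<and> (y, z) \<in> E O F" if near: "z \<in> X \<union> Y" "near z y" for z y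
  proof (cases "z = y")
    case False
    then obtain x where "x \<in> X" "z \<in> X" "f z = f x" "(x, y) \<in> E"
      using near unfolding near_def by blast
    then show ?thesis using f(2)[of z x] f(2)[of x z] sym[of x y] by auto
  qed simp
  show ?thesis
  proof (rule splitsI[of _ _ l])
    fix x y assume xy: "x \<in> X \<union> Y" "y \<in> X \<union> Y" "(x, y) \<in> E"
    have self: "near z z" if "z \<in> Y" for z using that by (simp add: near_def)
    consider "x \<in> Y" "y \<in> Y" | "x \<in> Y" "y \<notin> Y" | "x \<notin> Y" "y \<in> Y" | "x \<notin> Y" "y \<notin> Y" by blast
    then show "l x = l y"
    proof cases
      case 1
      then show ?thesis using l_near[OF self] g(1)[of x y] xy by simp
    next
      case 2
      then have "near y x" using xy sym[of x y] by (auto simp: near_def)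
      then show ?thesis using l_near[of y x] l_near[OF self] 2 by simp
    next
      case 3
      then have "near x y" using xy by (auto simp: near_def)
      then show ?thesis using l_near[of x y] l_near[OF self] 3 by simp
    next
      case 4
      then show ?thesis using l_cong[of x y] f(1)[of x y] xy by simp
    qed
  next
    fix x y assume xy: "x \<in> X \<union> Y" "y \<in> X \<union> Y" "l x = l y"
    show "(x, y) \<in> F \<union> H \<union> F O E O H \<union> H O E O F \<union> F O E O H O E O F"
    proof (cases "\<exists>u. near x u")
      case True
      then have "\<exists>v. near y v" using xy(3) by (auto simp: l_def split: if_splits)
      with True have near: "near x (p x)" "near y (p y)" using near_p by blast+
      then have "g (p x) = g (p y)" using l_near xy(3) by simp
      then have "(p x, p y) \<in> H" using near g(2)[of "p x" "p y"] by (simp add: near_def)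
      moreover have "x = p x \<or> (x, p x) \<in> F O E" "y = p y \<or> (p y, y) \<in> E O F"
        using near_FE near xy by blast+
      moreover have "(x, y) \<in> (F O E) O H O (E O F)" if "(x, p x) \<in> F O E" "(p y, y) \<in> E O F"
        using that calculation by blast
      moreover have "(x, y) \<in> (F O E) O H" if "(x, p x) \<in> F O E" "y = p y"
        using that calculation by auto
      moreover have "(x, y) \<in> H O (E O F)" if "x = p x" "(p y, y) \<in> E O F"
        using that calculation by auto
      ultimately show ?thesis by (auto simp: O_assoc)
    next
      case False
      then have "near x = (\<lambda>_. False)" by auto
      with False have *: "\<not> (\<exists>u. near y u)" "f x = f y"
        using xy(3) by (auto simp: l_def split: if_splits)
      then have "x \<notin> Y" "y \<notin> Y" using False by (auto simp: near_def)
      then show ?thesis using f(2)[of x y] * xy by simp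
    qed
  qed
qed

section \<open>Asymptotic dimension of a coarse structure\<close>

text \<open>The controlled relations abstract the relations \<open>d x y \<le> r\<close> of a metric space. Working with
  relations turns triangle inequalities into relational composition, and lets all groups, countable
  or not, be treated alike.\<close>

locale coarse_structure =
  fixes M :: "'a set" and \<E> :: "('a \<times> 'a) set set"
  assumes controlled_carrier: "E \<in> \<E> \<Longrightarrow> E \<subseteq> M \<times> M"
    and controlled_Id: "Id_on M \<in> \<E>"
    and controlled_subset: "F \<in> \<E> \<Longrightarrow> E \<subseteq> F \<Longrightarrow> E \<in> \<E>"
    and controlled_Un: "E \<in> \<E> \<Longrightarrow> F \<in> \<E> \<Longrightarrow> E \<union> F \<in> \<E>"
    and controlled_converse: "E \<in> \<E> \<Longrightarrow> E\<inverse> \<in> \<E>"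
    and controlled_relcomp: "E \<in> \<E> \<Longrightarrow> F \<in> \<E> \<Longrightarrow> E O F \<in> \<E>"
begin

text \<open>Separation at scale \<open>sym_refl E\<close> implies separation at scale \<open>E\<close>, so a scale may always be taken
  symmetric and reflexive.\<close>

definition sym_refl :: "('a \<times> 'a) set \<Rightarrow> ('a \<times> 'a) set" where
  "sym_refl E = E \<union> E\<inverse> \<union> Id_on M"

lemma sym_refl_controlled: "E \<in> \<E> \<Longrightarrow> sym_refl E \<in> \<E>"
  by (simp add: sym_refl_def controlled_Un controlled_converse controlled_Id)

lemma sym_sym_refl: "sym (sym_refl E)"
  by (auto simp: sym_refl_def sym_def)

lemma sym_refl_sym: "(x, y) \<in> sym_refl E \<Longrightarrow> (y, x) \<in> sym_refl E"
  using sym_sym_refl by (rule symD)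

lemma subset_sym_refl: "E \<subseteq> sym_refl E"
  by (auto simp: sym_refl_def)

lemma sym_refl_refl: "x \<in> M \<Longrightarrow> (x, x) \<in> sym_refl E"
  by (auto simp: sym_refl_def)

end

definition coarse_asdim_le :: "'a set \<Rightarrow> ('a \<times> 'a) set set \<Rightarrow> nat \<Rightarrow> bool" where
  "coarse_asdim_le M \<E> n \<longleftrightarrow>
     (\<forall>E\<in>\<E>. \<exists>F\<in>\<E>. \<exists>X. (\<forall>x\<in>M. \<exists>i\<le>n. x \<in> X i) \<and> (\<forall>i\<le>n. splits E F (X i)))"

lemma coarse_asdim_le_mono:
  assumes dim: "coarse_asdim_le M \<E> m" and "m \<le> n"
  shows "coarse_asdim_le M \<E> n"
  unfolding coarse_asdim_le_def
proof
  fix E assume "E \<in> \<E>"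
  then obtain F X where FX: "F \<in> \<E>" "\<forall>x\<in>M. \<exists>i\<le>m. x \<in> X i" "\<forall>i\<le>m. splits E F (X i)"
    using dim unfolding coarse_asdim_le_def by blast
  define Y where "Y i = (if i \<le> m then X i else {})" for i
  have "\<forall>x\<in>M. \<exists>i\<le>n. x \<in> Y i" using FX(2) \<open>m \<le> n\<close> unfolding Y_def by (metis order_trans)
  moreover have "\<forall>i\<le>n. splits E F (Y i)" using FX(3) by (simp add: Y_def)
  ultimately show "\<exists>F\<in>\<E>. \<exists>X. (\<forall>x\<in>M. \<exists>i\<le>n. x \<in> X i) \<and> (\<forall>i\<le>n. splits E F (X i))"
    using FX(1) by blast
qed

section \<open>Covers of high multiplicity\<close>

text \<open>Splitting is required only for the parts of \<open>X\<close> that lie in a \<open>T\<close>-bounded window \<open>W\<close>, with the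
  same bound \<open>F\<close> for all windows. For a map \<open>\<phi>\<close> the windows of interest are the subsets with bounded
  \<open>\<phi>\<close>-image, and then the notion describes sets that are uniformly split along the fibres of \<open>\<phi>\<close>. The
  dimension below is the corresponding dimension of a map; the windows are controlled by a second
  coarse structure \<open>\<T>\<close> on the same set.\<close>

definition window_splits ::
    "('a \<times> 'a) set \<Rightarrow> ('a \<times> 'a) set \<Rightarrow> ('a \<times> 'a) set \<Rightarrow> 'a set \<Rightarrow> bool" where
  "window_splits T E F X \<longleftrightarrow> (\<forall>W. W \<times> W \<subseteq> T \<longrightarrow> splits E F (X \<inter> W))"

definition window_asdim_le ::
    "'a set \<Rightarrow> ('a \<times> 'a) set set \<Rightarrow> ('a \<times> 'a) set set \<Rightarrow> nat \<Rightarrow> bool" where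
  "window_asdim_le M \<E> \<T> n \<longleftrightarrow>
     (\<forall>T\<in>\<T>. \<forall>E\<in>\<E>. \<exists>F\<in>\<E>. \<exists>X.
        (\<forall>x\<in>M. \<exists>i\<le>n. x \<in> X i) \<and> (\<forall>i\<le>n. window_splits T E F (X i)))"

text \<open>Kolmogorov's trick: a cover by \<open>n + 1\<close> split sets can be enlarged to \<open>n + m + 1\<close> split sets that
  cover every point at least \<open>m + 1\<close> times. One set is added at a time: the old sets \<open>X i\<close> are replaced
  by their neighbourhoods \<open>e `` X i\<close>, and the new set consists of the points \<open>x\<close> that are still covered
  only \<open>m + 1\<close> times. For such \<open>x\<close> the set \<open>D x\<close> of indices of neighbourhoods containing \<open>x\<close> equals
  the set of \<open>i\<close> with \<open>x \<in> X i\<close>, because the latter is contained in \<open>D x\<close> and has at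
  least \<open>m + 1\<close> elements. A point of the new set close to \<open>x\<close> lies in the same neighbourhoods, so \<open>D\<close> is constant along chains in the new set, and the pieces of
  any \<open>X i\<close> with \<open>i \<in> D x\<close> bound those chains. The neighbourhood of a window is a slightly larger
  window, which is why the hypothesis concerns all \<open>T\<close> at once.\<close>

lemma window_asdim_multiplicity:
  fixes M :: "'a set"
  assumes "coarse_structure M \<E>" "coarse_structure M \<T>" "\<E> \<subseteq> \<T>"
    and dim: "window_asdim_le M \<E> \<T> n" and "T \<in> \<T>" "E \<in> \<E>"
  shows "\<exists>F\<in>\<E>. \<exists>X. (\<forall>x\<in>M. m < card {i. i \<le> n + m \<and> x \<in> X i}) \<and>
    (\<forall>i\<le>n + m. window_splits T E F (X i))"
proof -
  interpret \<E>: coarse_structure M \<E> by fact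
  interpret \<T>: coarse_structure M \<T> by fact
  show ?thesis
    using \<open>T \<in> \<T>\<close> \<open>E \<in> \<E>\<close>
  proof (induction m arbitrary: T E)
    case 0
    obtain F X where FX: "F \<in> \<E>" "\<forall>x\<in>M. \<exists>i\<le>n. x \<in> X i" "\<forall>i\<le>n. window_splits T E F (X i)"
      using dim 0 unfolding window_asdim_le_def by blast
    have "0 < card {i. i \<le> n + 0 \<and> x \<in> X i}" if "x \<in> M" for x
      using FX(2) that by (auto simp: card_gt_0_iff)
    then show ?case using FX by (intro bexI[of _ F] exI[of _ X]) auto
  next
    case (Suc m)
    define e where "e = \<E>.sym_refl E"
    have e: "e \<in> \<E>" "E \<subseteq> e" "e \<in> \<T>"
      using Suc.prems \<open>\<E> \<subseteq> \<T>\<close> by (auto simp: e_def \<E>.sym_refl_controlled \<E>.subset_sym_refl)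
    have e_sym: "(y, x) \<in> e" if "(x, y) \<in> e" for x y
      using that unfolding e_def by (rule \<E>.sym_refl_sym)
    have e_refl: "(x, x) \<in> e" if "x \<in> M" for x
      using that unfolding e_def by (rule \<E>.sym_refl_refl)
    have T_M: "T \<subseteq> M \<times> M" and e_M: "e \<subseteq> M \<times> M"
      using Suc.prems e \<T>.controlled_carrier by auto
    have "e O T O e \<in> \<T>" "e O e O e \<in> \<E>"
      using Suc.prems e by (simp_all add: \<E>.controlled_relcomp \<T>.controlled_relcomp)
    from Suc.IH[OF this] obtain F X where F: "F \<in> \<E>"
      and mult: "\<And>x. x \<in> M \<Longrightarrow> m < card {i. i \<le> n + m \<and> x \<in> X i}"
      and split: "\<And>i. i \<le> n + m \<Longrightarrow> window_splits (e O T O e) (e O e O e) F (X i)"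
      by blast
    define D where "D x = {i. i \<le> n + m \<and> x \<in> e `` X i}" for x
    define X' where "X' i = (if i \<le> n + m then e `` X i else {x \<in> M. card (D x) = Suc m})" for i
    have fin_D: "finite (D x)" for x by (simp add: D_def)
    have D_X: "{i. i \<le> n + m \<and> x \<in> X i} \<subseteq> D x" if "x \<in> M" for x
      using e_refl[OF that] by (auto simp: D_def)
    have card_D: "m < card (D x)" if "x \<in> M" for x
      using mult[OF that] card_mono[OF fin_D D_X[OF that]] by linarith
    have "Suc m < card {i. i \<le> n + Suc m \<and> x \<in> X' i}" if x: "x \<in> M" for x
    proof -
      let ?I = "{i. i \<le> n + Suc m \<and> x \<in> X' i}"
      have D_I: "D x \<subseteq> ?I" unfolding D_def X'_def by force
      show ?thesis
      proof (cases "card (D x) = Suc m")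
        case True
        then have "x \<in> X' (n + Suc m)" using x by (simp add: X'_def)
        then have "insert (n + Suc m) (D x) \<subseteq> ?I" using D_I by blast
        then have "card (insert (n + Suc m) (D x)) \<le> card ?I" by (intro card_mono) simp_all
        moreover have "n + Suc m \<notin> D x" by (simp add: D_def)
        ultimately show ?thesis using True fin_D[of x] by simp
      next
        case False
        have "card (D x) \<le> card ?I" using D_I by (intro card_mono) simp_all
        then show ?thesis using False card_D[OF x] by linarith
      qed
    qed
    moreover have "window_splits T E (e O F O e \<union> F) (X' i)" if i: "i \<le> n + Suc m" for i
      unfolding window_splits_def
    proof (intro allI impI)
      fix W assume W: "W \<times> W \<subseteq> T"
      show "splits E (e O F O e \<union> F) (X' i \<inter> W)"
      proof (cases "i \<le> n + m")
        case True
        define V where "V = {x. \<exists>w\<in>W. (x, w) \<in> e}"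
        have "V \<times> V \<subseteq> e O T O e" using W e_sym by (force simp: V_def)
        then have "splits (e O e O e) F (X i \<inter> V)"
          using split[OF True] unfolding window_splits_def by blast
        then obtain f :: "'a \<Rightarrow> 'a set" where "labels (e O e O e) F (X i \<inter> V) f"
          unfolding splits_def by blast
        note f = labelsD[OF this]
        \<comment> \<open>Every point of the neighbourhood inherits the piece of a nearby point \<open>p y\<close> of \<open>X i\<close>.\<close>
        define p where "p y = (SOME x. x \<in> X i \<and> (x, y) \<in> e)" for y
        have p: "p y \<in> X i" "(p y, y) \<in> e" "p y \<in> V" if "y \<in> X' i \<inter> W" for y
        proof -
          have "\<exists>x. x \<in> X i \<and> (x, y) \<in> e" using that True by (auto simp: X'_def)
          then have "p y \<in> X i \<and> (p y, y) \<in> e" unfolding p_def by (rule someI_ex)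
          then show "p y \<in> X i" "(p y, y) \<in> e" "p y \<in> V" using that by (auto simp: V_def)
        qed
        show ?thesis
        proof (rule splitsI[of _ _ "\<lambda>y. f (p y)"])
          fix y z assume yz: "y \<in> X' i \<inter> W" "z \<in> X' i \<inter> W" "(y, z) \<in> E"
          then have "(p y, p z) \<in> e O e O e"
            using p[of y] p[of z] e(2) e_sym by blast
          then show "f (p y) = f (p z)" using yz p by (intro f(1)) auto
        next
          fix y z assume yz: "y \<in> X' i \<inter> W" "z \<in> X' i \<inter> W" "f (p y) = f (p z)"
          then have "(p y, p z) \<in> F" using p by (intro f(2)) auto
          then show "(y, z) \<in> e O F O e \<union> F" using yz p[of y] p[of z] e_sym by blast
        qed
      next
        case False
        then have X'_i: "X' i = {x \<in> M. card (D x) = Suc m}" by (simp add: X'_def)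
        have D_eq: "D x = {j. j \<le> n + m \<and> x \<in> X j}" if "x \<in> X' i" for x
          using that D_X[of x] mult[of x] card_mono[OF fin_D D_X[of x]]
          by (intro card_subset_eq[symmetric, OF fin_D]) (auto simp: X'_i)
        have T_sub: "T \<subseteq> e O T O e" using T_M e_refl by blast
        have "\<forall>j. \<exists>f :: 'a \<Rightarrow> 'a set. j \<le> n + m \<longrightarrow> labels (e O e O e) F (X j \<inter> W) f"
          using split W T_sub unfolding window_splits_def splits_def by (meson order_trans)
        then obtain f :: "nat \<Rightarrow> 'a \<Rightarrow> 'a set"
          where "\<And>j. j \<le> n + m \<Longrightarrow> labels (e O e O e) F (X j \<inter> W) (f j)"
          by metis
        note f = labelsD[OF this]
        have Min_D: "Min (D x) \<le> n + m" "x \<in> X (Min (D x))" if "x \<in> X' i" for x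
        proof -
          have "D x \<noteq> {}" using that by (auto simp: X'_i)
          then have "Min (D x) \<in> D x" using fin_D by (intro Min_in)
          then show "Min (D x) \<le> n + m" "x \<in> X (Min (D x))" using D_eq[OF that] by auto
        qed
        show ?thesis
        proof (rule splitsI[of _ _ "\<lambda>x. (D x, f (Min (D x)) x)"])
          fix x y assume xy: "x \<in> X' i \<inter> W" "y \<in> X' i \<inter> W" "(x, y) \<in> E"
          have "D x \<subseteq> D y" using xy D_eq[of x] e(2) by (auto simp: D_def)
          then have "D x = D y" using xy by (intro card_subset_eq[OF fin_D]) (auto simp: X'_i)
          moreover have "(x, y) \<in> e O e O e"
          proof -
            have "(x, y) \<in> e" "(y, y) \<in> e" using xy e(2) e_M e_refl by auto
            then show ?thesis by blast
          qed
          ultimately show "(D x, f (Min (D x)) x) = (D y, f (Min (D y)) y)"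
            using xy f[of "Min (D x)" x y] Min_D[of x] Min_D[of y] by auto
        next
          fix x y assume xy: "x \<in> X' i \<inter> W" "y \<in> X' i \<inter> W"
            "(D x, f (Min (D x)) x) = (D y, f (Min (D y)) y)"
          then show "(x, y) \<in> e O F O e \<union> F"
            using f[of "Min (D x)" x y] Min_D[of x] Min_D[of y] by auto
        qed
      qed
    qed
    ultimately show ?case
      using F e by (intro bexI[of _ "e O F O e \<union> F"] exI[of _ X'] conjI ballI allI impI)
        (auto intro: \<E>.controlled_Un \<E>.controlled_relcomp)
  qed
qed

text \<open>If every relation controls windows, then the whole space is a window, and window dimension is
  the ordinary dimension.\<close>

lemma coarse_structure_Pow: "coarse_structure M (Pow (M \<times> M))"
  by standard auto

lemma coarse_asdim_multiplicity:
  assumes M: "coarse_structure M \<E>" and dim: "coarse_asdim_le M \<E> n" and E: "E \<in> \<E>"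
  shows "\<exists>F\<in>\<E>. \<exists>X. (\<forall>x\<in>M. m < card {i. i \<le> n + m \<and> x \<in> X i}) \<and>
    (\<forall>i\<le>n + m. splits E F (X i \<inter> M))"
proof -
  interpret coarse_structure M \<E> by fact
  have "window_asdim_le M \<E> (Pow (M \<times> M)) n"
    unfolding window_asdim_le_def
  proof (intro ballI)
    fix T E assume "E \<in> \<E>"
    then obtain F X where "F \<in> \<E>" "\<forall>x\<in>M. \<exists>i\<le>n. x \<in> X i" "\<forall>i\<le>n. splits E F (X i)"
      using dim unfolding coarse_asdim_le_def by blast
    moreover from this have "\<forall>i\<le>n. window_splits T E F (X i)"
      unfolding window_splits_def using splits_mono[OF _ inf_le1 order_refl order_refl] by blast
    ultimately show "\<exists>F\<in>\<E>. \<exists>X. (\<forall>x\<in>M. \<exists>i\<le>n. x \<in> X i) \<and> (\<forall>i\<le>n. window_splits T E F (X i))"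
      by blast
  qed
  moreover have "\<E> \<subseteq> Pow (M \<times> M)" using controlled_carrier by blast
  ultimately obtain F X where "F \<in> \<E>" "\<forall>x\<in>M. m < card {i. i \<le> n + m \<and> x \<in> X i}"
    "\<forall>i\<le>n + m. window_splits (M \<times> M) E F (X i)"
    using window_asdim_multiplicity[OF M coarse_structure_Pow, of n "M \<times> M" E m] E by blast
  then show ?thesis unfolding window_splits_def by blast
qed

section \<open>The dimension of the total space of a map\<close>

text \<open>The dimension of the source is at most that of the target plus that of the fibres. First,
  the covers of the individual fibres have to be merged into \<open>n + 1\<close> sets covering everything and split
  in windows with \<open>T\<close>-bounded image (the fact \<open>window\<close>). The base is a union of finitely many
  sets \<open>Q c\<close>, whose pieces are bounded but far apart. A \<open>T\<close>-bounded window sees at most one piece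
  of each \<open>Q c\<close>, so over one \<open>Q c\<close> the covers can be chosen piece by piece; the finitely many \<open>Q c\<close> are
  then put together with \<open>splits_Un\<close>, choosing each scale larger than the bounds obtained before.

  Second, with multiplicities raised there are \<open>n + m + 1\<close> sets \<open>X i\<close> in the source containing every
  point \<open>m + 1\<close> times, and \<open>n + m + 1\<close> sets \<open>Y i\<close> in the target containing every point \<open>n + 1\<close> times.
  For each \<open>x\<close> there is then an index \<open>i\<close> with \<open>x \<in> X i\<close> and \<open>\<phi> x \<in> Y i\<close>, so the sets \<open>Z i\<close> of points
  with both properties form a cover. They split: a piece of \<open>Y i\<close> is bounded, its preimage is a
  window, and in this window \<open>X i\<close> splits.\<close>

theorem coarse_hurewicz:
  fixes M :: "'a set" and N :: "'b set" and \<phi> :: "'a \<Rightarrow> 'b"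
  assumes "coarse_structure M \<E>" "coarse_structure N \<F>"
    and \<phi>: "\<And>x. x \<in> M \<Longrightarrow> \<phi> x \<in> N" "\<And>E. E \<in> \<E> \<Longrightarrow> map_prod \<phi> \<phi> ` E \<in> \<F>"
    and base: "coarse_asdim_le N \<F> m"
    and fibre: "\<And>T E. \<lbrakk>T \<in> \<F>; E \<in> \<E>\<rbrakk> \<Longrightarrow> \<exists>F\<in>\<E>. \<forall>W\<subseteq>M. (\<forall>x\<in>W. \<forall>y\<in>W. (\<phi> x, \<phi> y) \<in> T) \<longrightarrow>
      (\<exists>X. (\<forall>x\<in>W. \<exists>i\<le>n. x \<in> X i) \<and> (\<forall>i\<le>n. splits E F (X i)))"
  shows "coarse_asdim_le M \<E> (n + m)"
proof -
  interpret \<E>: coarse_structure M \<E> by fact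
  interpret \<F>: coarse_structure N \<F> by fact
  let ?im = "\<lambda>T. map_prod \<phi> \<phi> ` T"
  define \<T> where "\<T> = {T. T \<subseteq> M \<times> M \<and> ?im T \<in> \<F>}"
  have \<T>: "coarse_structure M \<T>"
  proof
    have "?im (Id_on M) \<subseteq> Id_on N" using \<phi>(1) by auto
    then show "Id_on M \<in> \<T>"
      using \<F>.controlled_subset[OF \<F>.controlled_Id] by (auto simp: \<T>_def)
  next
    fix E F assume EF: "E \<in> \<T>" "F \<in> \<T>"
    have "?im (E O F) \<subseteq> ?im E O ?im F" by force
    then show "E O F \<in> \<T>"
      using EF \<F>.controlled_subset[OF \<F>.controlled_relcomp] unfolding \<T>_def by blast
    show "E \<union> F \<in> \<T>" using EF \<F>.controlled_Un by (auto simp: \<T>_def image_Un)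
  next
    fix E assume E: "E \<in> \<T>"
    have "?im (E\<inverse>) = (?im E)\<inverse>" by force
    then show "E\<inverse> \<in> \<T>" using E \<F>.controlled_converse by (auto simp: \<T>_def)
  next
    fix E F assume "F \<in> \<T>" "E \<subseteq> F"
    then show "E \<in> \<T>"
      using \<F>.controlled_subset[of "?im F" "?im E"] unfolding \<T>_def by blast
  qed (auto simp: \<T>_def)
  have sub: "\<E> \<subseteq> \<T>" using \<E>.controlled_carrier \<phi>(2) by (auto simp: \<T>_def)
  have window: "window_asdim_le M \<E> \<T> n"
    unfolding window_asdim_le_def
  proof (intro ballI)
    fix T E assume T: "T \<in> \<T>" and E: "E \<in> \<E>"
    then have "?im T \<in> \<F>" by (simp add: \<T>_def)
    then obtain B Q where B: "B \<in> \<F>" and "\<forall>y\<in>N. \<exists>c\<le>m. y \<in> Q c"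
      "\<forall>c\<le>m. splits (?im T) B (Q c)"
      using base unfolding coarse_asdim_le_def by blast
    note Q = this(2)[rule_format] and Q_splits = this(3)[rule_format]
    have piece: "\<exists>F\<in>\<E>. \<exists>X. (\<forall>x\<in>M. \<phi> x \<in> Q c \<longrightarrow> (\<exists>i\<le>n. x \<in> X i)) \<and>
        (\<forall>i\<le>n. window_splits T E F (X i))" if c: "c \<le> m" and E: "E \<in> \<E>" for c E
    proof -
      obtain h :: "'b \<Rightarrow> 'b set" where "labels (?im T) B (Q c) h"
        using Q_splits[OF c] unfolding splits_def by blast
      note h = labelsD[OF this]
      obtain F where F: "F \<in> \<E>" "\<And>W. W \<subseteq> M \<Longrightarrow> (\<forall>x\<in>W. \<forall>y\<in>W. (\<phi> x, \<phi> y) \<in> B) \<Longrightarrow>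
          \<exists>X. (\<forall>x\<in>W. \<exists>i\<le>n. x \<in> X i) \<and> (\<forall>i\<le>n. splits E F (X i))"
        using fibre[OF B E] by blast
      let ?W = "\<lambda>l. {x \<in> M. \<phi> x \<in> Q c \<and> h (\<phi> x) = l}"
      have "\<exists>X. (\<forall>x\<in>?W l. \<exists>i\<le>n. x \<in> X i) \<and> (\<forall>i\<le>n. splits E F (X i))" for l
        by (rule F(2)) (auto intro: h(2))
      then obtain X where X: "\<And>l x. x \<in> ?W l \<Longrightarrow> \<exists>i\<le>n. x \<in> X l i"
        "\<And>l i. i \<le> n \<Longrightarrow> splits E F (X l i)"
        by metis
      define Y where "Y i = {x \<in> M. \<phi> x \<in> Q c \<and> x \<in> X (h (\<phi> x)) i}" for i
      have "window_splits T E F (Y i)" if i: "i \<le> n" for i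
        unfolding window_splits_def
      proof (intro allI impI)
        fix W assume W: "W \<times> W \<subseteq> T"
        have lab: "h (\<phi> x) = h (\<phi> y)" if "x \<in> Y i \<inter> W" "y \<in> Y i \<inter> W" for x y
          using that W by (intro h(1)) (force simp: Y_def)+
        show "splits E F (Y i \<inter> W)"
        proof (cases "Y i \<inter> W = {}")
          case False
          then obtain z where z: "z \<in> Y i \<inter> W" by blast
          have "Y i \<inter> W \<subseteq> X (h (\<phi> z)) i" using lab[OF z] by (auto simp: Y_def)
          then show ?thesis using splits_mono[OF X(2)[OF i]] by blast
        qed simp
      qed
      moreover have "\<exists>i\<le>n. x \<in> Y i" if "x \<in> M" "\<phi> x \<in> Q c" for x
        using X(1)[of x "h (\<phi> x)"] that by (auto simp: Y_def)
      ultimately show ?thesis using F(1) by blast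
    qed
    have "\<exists>F\<in>\<E>. \<exists>X. (\<forall>x\<in>M. (\<exists>j<c. \<phi> x \<in> Q j) \<longrightarrow> (\<exists>i\<le>n. x \<in> X i)) \<and>
        (\<forall>i\<le>n. window_splits T E F (X i))" if "c \<le> Suc m" "E \<in> \<E>" for c E
      using that
    proof (induction c arbitrary: E)
      case 0
      show ?case
        using 0 by (intro bexI[of _ E] exI[of _ "\<lambda>_. {}"]) (auto simp: window_splits_def)
    next
      case (Suc c)
      define e where "e = \<E>.sym_refl E"
      have e: "e \<in> \<E>" "E \<subseteq> e" "sym e"
        using Suc.prems by (auto simp: e_def \<E>.sym_refl_controlled \<E>.subset_sym_refl \<E>.sym_sym_refl)
      obtain F X where F: "F \<in> \<E>"
        and X: "\<forall>x\<in>M. (\<exists>j<c. \<phi> x \<in> Q j) \<longrightarrow> (\<exists>i\<le>n. x \<in> X i)"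
          "\<forall>i\<le>n. window_splits T e F (X i)"
        using Suc.IH[of e] Suc.prems e by auto
      have "e \<union> e O F O e \<in> \<E>"
        using e F by (intro \<E>.controlled_Un \<E>.controlled_relcomp)
      then obtain H Y where H: "H \<in> \<E>" and Y: "\<forall>x\<in>M. \<phi> x \<in> Q c \<longrightarrow> (\<exists>i\<le>n. x \<in> Y i)"
          "\<forall>i\<le>n. window_splits T (e \<union> e O F O e) H (Y i)"
        using piece[of c "e \<union> e O F O e"] Suc.prems by auto
      let ?K = "F \<union> H \<union> F O e O H \<union> H O e O F \<union> F O e O H O e O F"
      have "window_splits T E ?K (X i \<union> Y i)" if i: "i \<le> n" for i
        unfolding window_splits_def
      proof (intro allI impI)
        fix W assume "W \<times> W \<subseteq> T"
        then have "splits e ?K (X i \<inter> W \<union> Y i \<inter> W)"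
          using X(2) Y(2) i e(3) unfolding window_splits_def by (intro splits_Un) auto
        then show "splits E ?K ((X i \<union> Y i) \<inter> W)"
          by (rule splits_mono) (use e in auto)
      qed
      moreover have "?K \<in> \<E>"
        using e F H by (intro \<E>.controlled_Un \<E>.controlled_relcomp)
      moreover have "\<exists>i\<le>n. x \<in> X i \<union> Y i" if "x \<in> M" "\<exists>j<Suc c. \<phi> x \<in> Q j" for x
        using that X(1) Y(1) by (metis UnCI less_Suc_eq)
      ultimately show ?case by (intro bexI[of _ ?K] exI[of _ "\<lambda>i. X i \<union> Y i"]) auto
    qed
    from this[of "Suc m" E] E obtain F X where "F \<in> \<E>" "\<forall>i\<le>n. window_splits T E F (X i)"
      and X: "\<forall>x\<in>M. (\<exists>j<Suc m. \<phi> x \<in> Q j) \<longrightarrow> (\<exists>i\<le>n. x \<in> X i)"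
      by blast
    moreover have "\<exists>j<Suc m. \<phi> x \<in> Q j" if "x \<in> M" for x
      using Q[OF \<phi>(1)[OF that]] less_Suc_eq_le by blast
    then have "\<forall>x\<in>M. \<exists>i\<le>n. x \<in> X i" using X by blast
    ultimately show "\<exists>F\<in>\<E>. \<exists>X. (\<forall>x\<in>M. \<exists>i\<le>n. x \<in> X i) \<and> (\<forall>i\<le>n. window_splits T E F (X i))"
      by blast
  qed
  show ?thesis
    unfolding coarse_asdim_le_def
  proof
    fix E assume E: "E \<in> \<E>"
    obtain B Y where B: "B \<in> \<F>"
      and "\<forall>y\<in>N. n < card {i. i \<le> m + n \<and> y \<in> Y i}"
        "\<forall>i\<le>m + n. splits (?im E) B (Y i \<inter> N)"
      using coarse_asdim_multiplicity[OF assms(2) base \<phi>(2)[OF E], of n] by blast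
    note Y = this(2,3)[rule_format]
    \<comment> \<open>Preimages of the pieces of \<open>Y i\<close> are \<open>T\<close>-bounded windows.\<close>
    define T where "T = {(x, y) \<in> M \<times> M. (\<phi> x, \<phi> y) \<in> B}"
    have "?im T \<subseteq> B" by (auto simp: T_def)
    then have "T \<in> \<T>" using \<F>.controlled_subset[OF B] by (auto simp: \<T>_def T_def)
    then obtain F X where F: "F \<in> \<E>"
      and "\<forall>x\<in>M. m < card {i. i \<le> n + m \<and> x \<in> X i}"
        "\<forall>i\<le>n + m. window_splits T E F (X i)"
      using window_asdim_multiplicity[OF assms(1) \<T> sub window, of T E m] E by blast
    note X = this(2,3)[rule_format]
    define Z where "Z i = {x \<in> M. x \<in> X i \<and> \<phi> x \<in> Y i}" for i
    have "\<exists>i\<le>n + m. x \<in> Z i" if x: "x \<in> M" for x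
    proof (rule ccontr)
      assume "\<not> (\<exists>i\<le>n + m. x \<in> Z i)"
      then have disj: "{i. i \<le> n + m \<and> x \<in> X i} \<inter> {i. i \<le> m + n \<and> \<phi> x \<in> Y i} = {}"
        using x by (auto simp: Z_def add.commute)
      have "card ({i. i \<le> n + m \<and> x \<in> X i} \<union> {i. i \<le> m + n \<and> \<phi> x \<in> Y i}) \<le> card {..n + m}"
        by (rule card_mono) auto
      then show False
        using X(1)[OF x] Y(1)[OF \<phi>(1)[OF x]] card_Un_disjoint[OF _ _ disj] by simp
    qed
    moreover have "splits E F (Z i)" if i: "i \<le> n + m" for i
    proof -
      obtain h :: "'b \<Rightarrow> 'b set" where "labels (?im E) B (Y i \<inter> N) h"
        using Y(2)[of i] i unfolding splits_def by (auto simp: add.commute)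
      note h = labelsD[OF this]
      let ?W = "\<lambda>l. {x \<in> M. \<phi> x \<in> Y i \<and> h (\<phi> x) = l}"
      have "?W l \<times> ?W l \<subseteq> T" for l
        using h(2) \<phi>(1) by (fastforce simp: T_def)
      then have "splits E F (X i \<inter> ?W l)" for l
        using X(2)[OF i] unfolding window_splits_def by blast
      then obtain f :: "'b set \<Rightarrow> 'a \<Rightarrow> 'a set" where "\<And>l. labels E F (X i \<inter> ?W l) (f l)"
        unfolding splits_def by metis
      note f = labelsD[OF this]
      show ?thesis
      proof (rule splitsI[of _ _ "\<lambda>x. (h (\<phi> x), f (h (\<phi> x)) x)"])
        fix x y assume xy: "x \<in> Z i" "y \<in> Z i" "(x, y) \<in> E"
        then have "h (\<phi> x) = h (\<phi> y)"
          using \<phi>(1) by (intro h(1)) (force simp: Z_def)+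
        then show "(h (\<phi> x), f (h (\<phi> x)) x) = (h (\<phi> y), f (h (\<phi> y)) y)"
          using xy f[of x "h (\<phi> x)" y] by (simp add: Z_def)
      next
        fix x y assume "x \<in> Z i" "y \<in> Z i"
          "(h (\<phi> x), f (h (\<phi> x)) x) = (h (\<phi> y), f (h (\<phi> y)) y)"
        then show "(x, y) \<in> F"
          using f(2)[of x "h (\<phi> x)" y] by (auto simp: Z_def)
      qed
    qed
    ultimately show "\<exists>F\<in>\<E>. \<exists>X. (\<forall>x\<in>M. \<exists>i\<le>n + m. x \<in> X i) \<and> (\<forall>i\<le>n + m. splits E F (X i))"
      using F by blast
  qed
qed

section \<open>Groups as coarse spaces\<close>

text \<open>Controlled relations are those with finitely many differences \<open>x\<inverse> y\<close>. This is defined for every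
  group, is compatible with passing to subgroups, and for a proper left invariant metric it describes
  the relations of bounded distance.\<close>

definition group_coarse :: "('a, 'b) monoid_scheme \<Rightarrow> ('a \<times> 'a) set set" where
  "group_coarse G = {E. E \<subseteq> carrier G \<times> carrier G \<and>
     finite ((\<lambda>(x, y). inv\<^bsub>G\<^esub> x \<otimes>\<^bsub>G\<^esub> y) ` E)}"

definition group_coarse_asdim_le :: "('a, 'b) monoid_scheme \<Rightarrow> nat \<Rightarrow> bool" where
  "group_coarse_asdim_le G n \<longleftrightarrow> coarse_asdim_le (carrier G) (group_coarse G) n"

lemma group_coarseI:
  assumes "finite S"
    and "\<And>x y. (x, y) \<in> E \<Longrightarrow> x \<in> carrier G \<and> y \<in> carrier G \<and> inv\<^bsub>G\<^esub> x \<otimes>\<^bsub>G\<^esub> y \<in> S"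
  shows "E \<in> group_coarse G"
proof -
  have "(\<lambda>(x, y). inv\<^bsub>G\<^esub> x \<otimes>\<^bsub>G\<^esub> y) ` E \<subseteq> S" using assms(2) by auto
  then have "finite ((\<lambda>(x, y). inv\<^bsub>G\<^esub> x \<otimes>\<^bsub>G\<^esub> y) ` E)" using assms(1) by (rule finite_subset)
  then show ?thesis using assms(2) by (auto simp: group_coarse_def)
qed

lemma group_coarseE:
  assumes "E \<in> group_coarse G"
  obtains S where "finite S" "\<forall>(x, y)\<in>E. x \<in> carrier G \<and> y \<in> carrier G \<and> inv\<^bsub>G\<^esub> x \<otimes>\<^bsub>G\<^esub> y \<in> S"
  using assms by (intro that[of "(\<lambda>(x, y). inv\<^bsub>G\<^esub> x \<otimes>\<^bsub>G\<^esub> y) ` E"]) (auto simp: group_coarse_def)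

context group
begin

lemma inv_mult_cancel:
  assumes "x \<in> carrier G" "y \<in> carrier G"
  shows "x \<otimes> (inv x \<otimes> y) = y" "inv x \<otimes> (x \<otimes> y) = y"
  using assms by (simp_all flip: m_assoc)

lemma coarse_structure_group: "coarse_structure (carrier G) (group_coarse G)"
proof
  show "E \<subseteq> carrier G \<times> carrier G" if "E \<in> group_coarse G" for E
    using that by (simp add: group_coarse_def)
  show "Id_on (carrier G) \<in> group_coarse G"
    by (rule group_coarseI[of "{\<one>}"]) auto
  show "E \<in> group_coarse G" if "F \<in> group_coarse G" "E \<subseteq> F" for E F
    using that finite_subset[OF image_mono[OF that(2)]] by (auto simp: group_coarse_def)
next
  fix E assume "E \<in> group_coarse G"
  then obtain S where S: "finite S"
    "\<forall>(x, y)\<in>E. x \<in> carrier G \<and> y \<in> carrier G \<and> inv x \<otimes> y \<in> S"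
    by (rule group_coarseE)
  show "E\<inverse> \<in> group_coarse G"
  proof (rule group_coarseI[of "m_inv G ` S"])
    fix y x assume "(y, x) \<in> E\<inverse>"
    then have xy: "x \<in> carrier G" "y \<in> carrier G" "inv x \<otimes> y \<in> S" using S by auto
    then have "inv y \<otimes> x = inv (inv x \<otimes> y)" by (simp add: inv_mult_group)
    then show "y \<in> carrier G \<and> x \<in> carrier G \<and> inv y \<otimes> x \<in> m_inv G ` S" using xy by blast
  qed (use S in simp)
next
  fix E F assume EF: "E \<in> group_coarse G" "F \<in> group_coarse G"
  then show "E \<union> F \<in> group_coarse G" by (auto simp: group_coarse_def image_Un)
  obtain S where S: "finite S"
    "\<forall>(x, y)\<in>E. x \<in> carrier G \<and> y \<in> carrier G \<and> inv x \<otimes> y \<in> S"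
    using EF(1) by (rule group_coarseE)
  obtain T where T: "finite T"
    "\<forall>(x, y)\<in>F. x \<in> carrier G \<and> y \<in> carrier G \<and> inv x \<otimes> y \<in> T"
    using EF(2) by (rule group_coarseE)
  show "E O F \<in> group_coarse G"
  proof (rule group_coarseI[of "(\<lambda>(s, t). s \<otimes> t) ` (S \<times> T)"])
    fix x z assume "(x, z) \<in> E O F"
    then obtain y where "(x, y) \<in> E" "(y, z) \<in> F" by blast
    then have xyz: "x \<in> carrier G" "y \<in> carrier G" "z \<in> carrier G" "inv x \<otimes> y \<in> S" "inv y \<otimes> z \<in> T"
      using S T by auto
    then have "inv x \<otimes> z = (inv x \<otimes> y) \<otimes> (inv y \<otimes> z)"
      by (simp add: m_assoc inv_mult_cancel)
    then show "x \<in> carrier G \<and> z \<in> carrier G \<and> inv x \<otimes> z \<in> (\<lambda>(s, t). s \<otimes> t) ` (S \<times> T)"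
      using xyz by force
  qed (use S T in simp)
qed

lemma group_coarse_asdim_le_subgroup:
  assumes dim: "group_coarse_asdim_le G n" and H: "subgroup H G"
  shows "group_coarse_asdim_le (G\<lparr>carrier := H\<rparr>) n"
  unfolding group_coarse_asdim_le_def coarse_asdim_le_def
proof
  let ?H = "G\<lparr>carrier := H\<rparr>"
  have inv: "inv\<^bsub>?H\<^esub> x = inv x" if "x \<in> H" for x using m_inv_consistent[OF H that] .
  have H_G: "H \<subseteq> carrier G" using H by (rule subgroup.subset)
  fix E assume "E \<in> group_coarse ?H"
  then obtain S where S: "finite S"
    "\<forall>(x, y)\<in>E. x \<in> carrier ?H \<and> y \<in> carrier ?H \<and> inv\<^bsub>?H\<^esub> x \<otimes>\<^bsub>?H\<^esub> y \<in> S"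
    by (rule group_coarseE)
  then have "E \<in> group_coarse G"
    using inv H_G by (intro group_coarseI[of S]) fastforce+
  then obtain F X where F: "F \<in> group_coarse G" and X: "\<forall>x\<in>carrier G. \<exists>i\<le>n. x \<in> X i"
    "\<forall>i\<le>n. splits E F (X i)"
    using dim unfolding group_coarse_asdim_le_def coarse_asdim_le_def by blast
  obtain T where T: "finite T"
    "\<forall>(x, y)\<in>F. x \<in> carrier G \<and> y \<in> carrier G \<and> inv x \<otimes> y \<in> T"
    using F by (rule group_coarseE)
  have "F \<inter> H \<times> H \<in> group_coarse ?H"
    using T inv by (intro group_coarseI[of T]) auto
  moreover have "splits E (F \<inter> H \<times> H) (X i \<inter> H)" if "i \<le> n" for i
  proof -
    obtain f :: "'a \<Rightarrow> 'a set" where "labels E F (X i) f"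
      using X(2) \<open>i \<le> n\<close> unfolding splits_def by blast
    then show ?thesis
      by (intro labels_imp_splits[of _ _ _ f]) (simp add: labels_def)
  qed
  moreover have "\<forall>x\<in>carrier ?H. \<exists>i\<le>n. x \<in> X i \<inter> H" using X(1) H_G by auto
  ultimately show "\<exists>F\<in>group_coarse ?H. \<exists>X. (\<forall>x\<in>carrier ?H. \<exists>i\<le>n. x \<in> X i) \<and>
      (\<forall>i\<le>n. splits E F (X i))"
    by (intro bexI[of _ "F \<inter> H \<times> H"] exI[of _ "\<lambda>i. X i \<inter> H"]) auto
qed

text \<open>Points related by differences in a finite set \<open>S\<close> lie in the same coset of the subgroup generated
  by \<open>S\<close>, which is finite.\<close>

lemma locally_finite_asdim_0:
  assumes fin: "\<And>S. finite S \<Longrightarrow> S \<subseteq> carrier G \<Longrightarrow> finite (generate G S)"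
  shows "group_coarse_asdim_le G 0"
  unfolding group_coarse_asdim_le_def coarse_asdim_le_def
proof
  fix E assume "E \<in> group_coarse G"
  then obtain S where S: "finite S"
    "\<forall>(x, y)\<in>E. x \<in> carrier G \<and> y \<in> carrier G \<and> inv x \<otimes> y \<in> S"
    by (rule group_coarseE)
  define H where "H = generate G (S \<inter> carrier G)"
  interpret H: subgroup H G unfolding H_def by (rule generate_is_subgroup) simp
  define F where "F = {(x, y). x \<in> carrier G \<and> y \<in> carrier G \<and> inv x \<otimes> y \<in> H}"
  have "finite H" unfolding H_def using S by (intro fin) auto
  then have "F \<in> group_coarse G" by (rule group_coarseI) (auto simp: F_def)
  moreover have "splits E F (carrier G)"
  proof (rule splitsI[of _ _ "\<lambda>x. x <# H"])
    fix x y assume xy: "x \<in> carrier G" "y \<in> carrier G" "(x, y) \<in> E"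
    then have "inv x \<otimes> y \<in> H" using S unfolding H_def by (intro generate.incl) auto
    then have "x \<otimes> (inv x \<otimes> y) \<in> x <# H" unfolding l_coset_def by blast
    then show "x <# H = y <# H"
      using xy by (intro l_repr_independence H.subgroup_axioms) (simp_all add: inv_mult_cancel)
  next
    fix x y assume xy: "x \<in> carrier G" "y \<in> carrier G" "x <# H = y <# H"
    have "y \<in> y <# H" using xy H.one_closed by (force simp: l_coset_def)
    then have "y \<in> x <# H" using xy(3) by simp
    then obtain h where "h \<in> H" "y = x \<otimes> h" by (auto simp: l_coset_def)
    then show "(x, y) \<in> F" using xy by (simp add: F_def inv_mult_cancel)
  qed
  ultimately show "\<exists>F\<in>group_coarse G. \<exists>X :: nat \<Rightarrow> 'a set. (\<forall>x\<in>carrier G. \<exists>i\<le>0. x \<in> X i) \<and> (\<forall>i\<le>0. splits E F (X i))"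
    by (intro bexI[of _ F] exI[of _ "\<lambda>_. carrier G"]) simp_all
qed

lemma finite_asdim_0:
  assumes "finite (carrier G)"
  shows "group_coarse_asdim_le G 0"
proof (rule locally_finite_asdim_0)
  show "finite (generate G S)" if "S \<subseteq> carrier G" for S
    using generate_incl[OF that] assms by (rule finite_subset)
qed

text \<open>An infinite cyclic group is the line of integers, cut into intervals of length \<open>L\<close> that are
  coloured alternately with two colours.\<close>

lemma cyclic_asdim_1:
  assumes q: "q \<in> carrier G" and gen: "carrier G = generate G {q}"
  shows "group_coarse_asdim_le G 1"
proof -
  define power :: "int \<Rightarrow> 'a" where "power k = q [^] k" for k
  have range: "carrier G = range power"
    using generate_pow[OF q] gen by (auto simp: power_def)
  have diff: "inv (power a) \<otimes> power b = power (b - a)" for a b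
    using int_pow_diff[OF q, of b a] int_pow_mult[OF q, of "- a" b] q
    by (simp add: power_def int_pow_neg)
  show ?thesis
  proof (cases "inj power")
    case False
    have "range power = carrier (subgroup_generated G {q})"
      using carrier_subgroup_generated_by_singleton[OF q] by (simp add: power_def)
    then have "finite (carrier G)"
      using infinite_cyclic_subgroup_int[OF q] False range
      by (auto simp: inj_def power_def)
    then have "group_coarse_asdim_le G 0" by (rule finite_asdim_0)
    then show ?thesis
      unfolding group_coarse_asdim_le_def by (rule coarse_asdim_le_mono) simp
  next
    case True
    define e where "e = inv_into UNIV power"
    have e: "power (e x) = x" if "x \<in> carrier G" for x
      using that by (simp add: e_def f_inv_into_f range)
    have diff_e: "inv x \<otimes> y = power (e y - e x)" if "x \<in> carrier G" "y \<in> carrier G" for x y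
      using diff[of "e x" "e y"] e that by simp
    show ?thesis
      unfolding group_coarse_asdim_le_def coarse_asdim_le_def
    proof
      fix E assume "E \<in> group_coarse G"
      then obtain S where S: "finite S"
        "\<forall>(x, y)\<in>E. x \<in> carrier G \<and> y \<in> carrier G \<and> inv x \<otimes> y \<in> S"
        by (rule group_coarseE)
      \<comment> \<open>Exponents of \<open>E\<close>-related points differ by at most \<open>L\<close>; including 1 keeps \<open>L\<close> positive.\<close>
      define L where "L = Max (insert 1 ((\<lambda>s. \<bar>e s\<bar>) ` S))"
      have L: "\<bar>e s\<bar> \<le> L" if "s \<in> S" for s
        using S that by (simp add: L_def)
      have "1 \<le> L" using S by (simp add: L_def)
      have close: "\<bar>e y - e x\<bar> \<le> L" if "(x, y) \<in> E" for x y
      proof -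
        have "e (inv x \<otimes> y) = e y - e x"
          using diff_e[of x y] S that True by (auto simp: e_def)
        then show ?thesis using L[of "inv x \<otimes> y"] S that by auto
      qed
      define F where "F = {(x, y). x \<in> carrier G \<and> y \<in> carrier G \<and> \<bar>e y - e x\<bar> < L}"
      have "F \<in> group_coarse G"
        by (rule group_coarseI[of "power ` {- L..L}"]) (auto simp: F_def diff_e intro!: imageI)
      moreover define X where "X i = {x \<in> carrier G. (e x div L) mod 2 = int i}" for i :: nat
      have "splits E F (X i)" for i
      proof (rule splitsI[of _ _ "\<lambda>x. e x div L"])
        fix x y assume xy: "x \<in> X i" "y \<in> X i" "(x, y) \<in> E"
        have "e y div L \<le> (e x + L) div L" "e x div L \<le> (e y + L) div L"
          using close[OF xy(3)] \<open>1 \<le> L\<close> by (intro zdiv_mono1; simp)+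
        then have "\<bar>e y div L - e x div L\<bar> \<le> 1" using \<open>1 \<le> L\<close> by simp
        moreover have "(e x div L) mod 2 = (e y div L) mod 2" using xy by (simp add: X_def)
        moreover have "a = b" if "\<bar>b - a\<bar> \<le> 1" "a mod 2 = b mod 2" for a b :: int
          using that by presburger
        ultimately show "e x div L = e y div L" by blast
      next
        fix x y assume xy: "x \<in> X i" "y \<in> X i" "e x div L = e y div L"
        have "e y - e x = e y mod L - e x mod L"
          using xy(3) by (metis add_diff_cancel_left div_mult_mod_eq)
        moreover have "0 \<le> e y mod L" "e y mod L < L" "0 \<le> e x mod L" "e x mod L < L"
          using \<open>1 \<le> L\<close> by simp_all
        ultimately have "\<bar>e y - e x\<bar> < L" by linarith
        then show "(x, y) \<in> F" using xy by (simp add: F_def X_def)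
      qed
      moreover have "\<exists>i\<le>1. x \<in> X i" if "x \<in> carrier G" for x
      proof -
        have "(e x div L) mod 2 = int 0 \<or> (e x div L) mod 2 = int 1" by auto
        then show ?thesis using that unfolding X_def by fastforce
      qed
      ultimately show "\<exists>F\<in>group_coarse G. \<exists>X :: nat \<Rightarrow> 'a set. (\<forall>x\<in>carrier G. \<exists>i\<le>1. x \<in> X i) \<and>
          (\<forall>i\<le>1. splits E F (X i))"
        by blast
    qed
  qed
qed

end

text \<open>The fibres of a homomorphism over a bounded set look like finitely many cosets of the kernel:
  if \<open>w\<close> is a base point of the window \<open>W\<close>, then the images of \<open>w\<inverse> x\<close> for \<open>x \<in> W\<close> range over a finite
  set, for which a finite set \<open>L\<close> of lifts is chosen. Dividing by the lift \<open>\<tau> x\<close> gives \<open>\<kappa> x\<close> in the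
  kernel with \<open>x = w \<kappa>(x) \<tau>(x)\<close>, and differences of \<open>x\<close> and of \<open>\<kappa> x\<close> determine each other up to \<open>L\<close>.
  As only differences matter, \<open>w\<close> drops out and the bounds are the same for all windows.\<close>

theorem (in group_hom) asdim_extension:
  assumes ker: "group_coarse_asdim_le (G\<lparr>carrier := kernel G H h\<rparr>) n"
    and base: "group_coarse_asdim_le H m"
  shows "group_coarse_asdim_le G (n + m)"
  unfolding group_coarse_asdim_le_def
proof (rule coarse_hurewicz[OF G.coarse_structure_group H.coarse_structure_group])
  show "h x \<in> carrier H" if "x \<in> carrier G" for x using that by simp
  show "map_prod h h ` E \<in> group_coarse H" if E: "E \<in> group_coarse G" for E
  proof -
    obtain S where S: "finite S"
      "\<forall>(x, y)\<in>E. x \<in> carrier G \<and> y \<in> carrier G \<and> inv x \<otimes> y \<in> S"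
      using E by (rule group_coarseE)
    show ?thesis
    proof (rule group_coarseI[of "h ` S"])
      fix u v assume "(u, v) \<in> map_prod h h ` E"
      then obtain x y where xy: "(x, y) \<in> E" "u = h x" "v = h y" by auto
      then have *: "x \<in> carrier G" "y \<in> carrier G" "inv x \<otimes> y \<in> S" using S by auto
      then have "inv\<^bsub>H\<^esub> u \<otimes>\<^bsub>H\<^esub> v = h (inv x \<otimes> y)" using xy by simp
      then have "inv\<^bsub>H\<^esub> u \<otimes>\<^bsub>H\<^esub> v \<in> h ` S" using *(3) by (rule image_eqI)
      then show "u \<in> carrier H \<and> v \<in> carrier H \<and> inv\<^bsub>H\<^esub> u \<otimes>\<^bsub>H\<^esub> v \<in> h ` S" using * xy by simp
    qed (use S in simp)
  qed
  show "coarse_asdim_le (carrier H) (group_coarse H) m"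
    using base by (simp add: group_coarse_asdim_le_def)
next
  let ?K = "kernel G H h"
  interpret K: subgroup ?K G by (rule subgroup_kernel)
  fix T E assume "T \<in> group_coarse H" "E \<in> group_coarse G"
  obtain P where P: "finite P"
    "\<forall>(x, y)\<in>T. x \<in> carrier H \<and> y \<in> carrier H \<and> inv\<^bsub>H\<^esub> x \<otimes>\<^bsub>H\<^esub> y \<in> P"
    using \<open>T \<in> group_coarse H\<close> by (rule group_coarseE)
  obtain S where S: "finite S"
    "\<forall>(x, y)\<in>E. x \<in> carrier G \<and> y \<in> carrier G \<and> inv x \<otimes> y \<in> S"
    using \<open>E \<in> group_coarse G\<close> by (rule group_coarseE)
  define \<sigma> where "\<sigma> = inv_into (carrier G) h"
  have \<sigma>: "\<sigma> p \<in> carrier G" "h (\<sigma> p) = p" if "p \<in> h ` carrier G" for p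
    using that by (simp_all add: \<sigma>_def inv_into_into f_inv_into_f)
  define L where "L = \<sigma> ` (P \<inter> h ` carrier G)"
  have L: "finite L" "L \<subseteq> carrier G" using P \<sigma>(1) by (auto simp: L_def)
  define E' where "E' = {(a, b). a \<in> ?K \<and> b \<in> ?K \<and>
    inv a \<otimes> b \<in> (\<lambda>(p, s, q). p \<otimes> s \<otimes> inv q) ` (L \<times> S \<times> L)}"
  have K_inv: "inv\<^bsub>G\<lparr>carrier := ?K\<rparr>\<^esub> a = inv a" if "a \<in> ?K" for a
    using G.m_inv_consistent[OF K.subgroup_axioms that] .
  have "E' \<in> group_coarse (G\<lparr>carrier := ?K\<rparr>)"
    by (rule group_coarseI[of "(\<lambda>(p, s, q). p \<otimes> s \<otimes> inv q) ` (L \<times> S \<times> L)"])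
      (use L S in \<open>auto simp: E'_def K_inv\<close>)
  then obtain F' X where F': "F' \<in> group_coarse (G\<lparr>carrier := ?K\<rparr>)"
    and X: "\<forall>x\<in>?K. \<exists>i\<le>n. x \<in> X i" "\<forall>i\<le>n. splits E' F' (X i)"
    using ker unfolding group_coarse_asdim_le_def coarse_asdim_le_def by fastforce
  obtain D where D: "finite D" "\<forall>(a, b)\<in>F'. a \<in> carrier (G\<lparr>carrier := ?K\<rparr>) \<and>
      b \<in> carrier (G\<lparr>carrier := ?K\<rparr>) \<and> inv\<^bsub>G\<lparr>carrier := ?K\<rparr>\<^esub> a \<otimes>\<^bsub>G\<lparr>carrier := ?K\<rparr>\<^esub> b \<in> D"
    using F' by (rule group_coarseE)
  have F'_D: "inv a \<otimes> b \<in> D" if "(a, b) \<in> F'" for a b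
    using D(2) that K_inv by fastforce
  define F where "F = {(x, y). x \<in> carrier G \<and> y \<in> carrier G \<and>
    inv x \<otimes> y \<in> (\<lambda>(p, d, q). inv p \<otimes> d \<otimes> q) ` (L \<times> D \<times> L)}"
  have "F \<in> group_coarse G"
    by (rule group_coarseI[of "(\<lambda>(p, d, q). inv p \<otimes> d \<otimes> q) ` (L \<times> D \<times> L)"])
      (use L D in \<open>auto simp: F_def\<close>)
  moreover have "\<exists>X. (\<forall>x\<in>W. \<exists>i\<le>n. x \<in> X i) \<and> (\<forall>i\<le>n. splits E F (X i))"
    if W: "W \<subseteq> carrier G" "\<forall>x\<in>W. \<forall>y\<in>W. (h x, h y) \<in> T" for W
  proof (cases "W = {}")
    case False
    then obtain w where w: "w \<in> W" by blast
    define \<tau> where "\<tau> x = \<sigma> (h (inv w \<otimes> x))" for x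
    define \<kappa> where "\<kappa> x = inv w \<otimes> x \<otimes> inv (\<tau> x)" for x
    have \<tau>: "\<tau> x \<in> L" "\<tau> x \<in> carrier G" "\<kappa> x \<in> ?K" "inv w \<otimes> x = \<kappa> x \<otimes> \<tau> x" if "x \<in> W" for x
    proof -
      have x: "x \<in> carrier G" "w \<in> carrier G" using that w W by auto
      have "(h w, h x) \<in> T" using W w that by blast
      then have "h (inv w \<otimes> x) \<in> P" using P x by auto
      moreover have img: "h (inv w \<otimes> x) \<in> h ` carrier G" using x by blast
      ultimately show \<tau>x: "\<tau> x \<in> L" unfolding \<tau>_def L_def by blast
      then show \<tau>G: "\<tau> x \<in> carrier G" using L by blast
      have h\<tau>: "h (\<tau> x) = h (inv w \<otimes> x)" unfolding \<tau>_def using \<sigma>(2)[OF img] .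
      have "inv w \<otimes> x \<in> carrier G" using x by simp
      then have "h (\<kappa> x) = h (inv w \<otimes> x) \<otimes>\<^bsub>H\<^esub> inv\<^bsub>H\<^esub> h (\<tau> x)"
        unfolding \<kappa>_def using \<tau>G by (simp only: hom_mult hom_inv G.inv_closed)
      also have "\<dots> = \<one>\<^bsub>H\<^esub>" unfolding h\<tau> using x by (intro H.r_inv hom_closed) simp
      finally have "h (\<kappa> x) = \<one>\<^bsub>H\<^esub>" .
      moreover have "\<kappa> x \<in> carrier G" using x \<tau>G unfolding \<kappa>_def by (intro G.m_closed G.inv_closed)
      ultimately show "\<kappa> x \<in> ?K" unfolding kernel_def by blast
      show "inv w \<otimes> x = \<kappa> x \<otimes> \<tau> x" using x \<tau>G by (simp add: \<kappa>_def G.m_assoc)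
    qed
    have diff: "inv x \<otimes> y = inv (\<tau> x) \<otimes> (inv (\<kappa> x) \<otimes> \<kappa> y) \<otimes> \<tau> y" if "x \<in> W" "y \<in> W" for x y
    proof -
      have carr: "x \<in> carrier G" "y \<in> carrier G" "w \<in> carrier G" "\<kappa> x \<in> carrier G" "\<kappa> y \<in> carrier G"
        using that w W \<tau>(3) K.subset by auto
      have "inv x \<otimes> y = inv (inv w \<otimes> x) \<otimes> (inv w \<otimes> y)"
        using carr by (simp add: G.inv_mult_group G.m_assoc G.inv_mult_cancel)
      then show ?thesis
        using carr that \<tau> by (simp add: G.inv_mult_group G.m_assoc)
    qed
    have \<kappa>_diff: "inv (\<kappa> x) \<otimes> \<kappa> y = \<tau> x \<otimes> (inv x \<otimes> y) \<otimes> inv (\<tau> y)" if "x \<in> W" "y \<in> W" for x y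
    proof -
      have "\<kappa> x \<in> carrier G" "\<kappa> y \<in> carrier G" using that \<tau>(3) K.subset by auto
      then show ?thesis
        using diff[OF that] that \<tau>(2) by (simp add: G.m_assoc G.inv_mult_cancel)
    qed
    define Z where "Z i = {x \<in> W. \<kappa> x \<in> X i}" for i
    have "splits E F (Z i)" if "i \<le> n" for i
    proof -
      obtain f :: "'a \<Rightarrow> 'a set" where "labels E' F' (X i) f"
        using X(2) \<open>i \<le> n\<close> unfolding splits_def by blast
      note f = labelsD[OF this]
      show ?thesis
      proof (rule splitsI[of _ _ "\<lambda>x. f (\<kappa> x)"])
        fix x y assume xy: "x \<in> Z i" "y \<in> Z i" "(x, y) \<in> E"
        then have "inv x \<otimes> y \<in> S" using S by auto
        moreover have "\<tau> x \<in> L" "\<tau> y \<in> L" using xy \<tau> by (auto simp: Z_def)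
        ultimately have "\<tau> x \<otimes> (inv x \<otimes> y) \<otimes> inv (\<tau> y) \<in> (\<lambda>(p, s, q). p \<otimes> s \<otimes> inv q) ` (L \<times> S \<times> L)"
          by (intro image_eqI[of _ _ "(\<tau> x, inv x \<otimes> y, \<tau> y)"]) auto
        then have "(\<kappa> x, \<kappa> y) \<in> E'"
          using xy \<kappa>_diff \<tau>(3) by (simp add: E'_def Z_def)
        then show "f (\<kappa> x) = f (\<kappa> y)" using xy f(1) by (simp add: Z_def)
      next
        fix x y assume xy: "x \<in> Z i" "y \<in> Z i" "f (\<kappa> x) = f (\<kappa> y)"
        then have "(\<kappa> x, \<kappa> y) \<in> F'" using f(2) by (simp add: Z_def)
        moreover have "\<tau> x \<in> L" "\<tau> y \<in> L" using xy \<tau> by (auto simp: Z_def)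
        ultimately have "inv (\<tau> x) \<otimes> (inv (\<kappa> x) \<otimes> \<kappa> y) \<otimes> \<tau> y \<in> (\<lambda>(p, d, q). inv p \<otimes> d \<otimes> q) ` (L \<times> D \<times> L)"
          using F'_D by (intro image_eqI[of _ _ "(\<tau> x, inv (\<kappa> x) \<otimes> \<kappa> y, \<tau> y)"]) auto
        then show "(x, y) \<in> F"
          using xy diff W by (auto simp: F_def Z_def)
      qed
    qed
    moreover have "\<forall>x\<in>W. \<exists>i\<le>n. x \<in> Z i" using X(1) \<tau>(3) by (fastforce simp: Z_def)
    ultimately show ?thesis by blast
  qed (auto intro!: exI[of _ "\<lambda>_. {}"])
  ultimately show "\<exists>F\<in>group_coarse G. \<forall>W\<subseteq>carrier G. (\<forall>x\<in>W. \<forall>y\<in>W. (h x, h y) \<in> T) \<longrightarrow>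
      (\<exists>X. (\<forall>x\<in>W. \<exists>i\<le>n. x \<in> X i) \<and> (\<forall>i\<le>n. splits E F (X i)))"
    by blast
qed

corollary (in group) asdim_extension_normal:
  assumes N: "N \<lhd> G"
    and "group_coarse_asdim_le (G\<lparr>carrier := N\<rparr>) n" "group_coarse_asdim_le (G Mod N) m"
  shows "group_coarse_asdim_le G (n + m)"
proof -
  interpret N: normal N G by fact
  interpret N: group_hom G "G Mod N" "\<lambda>x. N #> x"
    by (intro group_hom.intro group_hom_axioms.intro is_group N.factorgroup_is_group N.r_coset_hom_Mod)
  have "kernel G (G Mod N) (\<lambda>x. N #> x) = N"
    using coset_join1[OF _ _ N.subgroup_axioms] coset_join2[OF _ N.subgroup_axioms] N.subset
    by (auto simp: kernel_def)
  then show ?thesis using N.asdim_extension[of n m] assms by simp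
qed

section \<open>The rank of an abelian group\<close>

text \<open>The element \<open>a \<otimes> 1\<close> of the tensor product.\<close>

abbreviation unit_tensor :: "('a, 'b) monoid_scheme \<Rightarrow> 'a \<Rightarrow> ('a \<times> rat \<Rightarrow>\<^sub>0 int) set" where
  "unit_tensor A a \<equiv> rat_tensor_kernel A #>\<^bsub>rat_tensor_free A\<^esub> frag_of (a, 1)"

lemma ex_rat_denominator: "\<exists>N>0. \<exists>k :: int. of_int N * (q :: rat) = of_int k"
proof -
  obtain a b where "quotient_of q = (a, b)" by fastforce
  then have "q = of_int a / of_int b" "b > 0"
    using quotient_of_div quotient_of_denom_pos by auto
  then have "of_int b * q = of_int a" by simp
  then show ?thesis using \<open>b > 0\<close> by blast
qed

text \<open>The kernel of \<open>a \<mapsto> a \<otimes> 1\<close> consists of torsion elements. A proof that \<open>a \<otimes> 1\<close> vanishes uses finitely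
  many relations and hence finitely many rationals. If \<open>M\<close> is a multiple of all their denominators, the
  homomorphism \<open>(b, q) \<mapsto> b\<^sup>M\<^sup>q\<close> kills these relations and maps \<open>a \<otimes> 1\<close> to \<open>a\<^sup>M\<close>. The homomorphism is
  made total by rounding the exponent down; since \<open>M\<close> must serve several subproofs at once, the
  induction is for all multiples of some \<open>N\<close>.\<close>

lemma (in comm_group) rat_tensor_kernel_torsion:
  assumes a: "a \<in> carrier G" and ker: "frag_of (a, 1) \<in> rat_tensor_kernel G"
  shows "\<exists>N>0. a [^] (N :: int) = \<one>"
proof -
  let ?F = "rat_tensor_free G"
  define scales where "scales f M \<longleftrightarrow> f \<in> hom ?F G \<and>
    (\<forall>b\<in>carrier G. \<forall>q :: rat. f (frag_of (b, q)) = b [^] \<lfloor>of_int M * q\<rfloor>)" for f and M :: int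
  have F: "group ?F" by (simp add: rat_tensor_free_def)
  have ex: "\<exists>f. scales f M" for M
  proof -
    let ?g = "\<lambda>(b, q :: rat). b [^] \<lfloor>of_int M * q\<rfloor>"
    have "?g ` (carrier G \<times> UNIV) \<subseteq> carrier G" by auto
    then obtain f where "f \<in> hom (free_Abelian_group (carrier G \<times> UNIV)) G"
      "\<And>x. x \<in> carrier G \<times> UNIV \<Longrightarrow> f (frag_of x) = ?g x"
      using free_Abelian_group_universal by blast
    then show ?thesis unfolding scales_def rat_tensor_free_def by auto
  qed
  have gen: "frag_of (b, q) \<in> carrier ?F" if "b \<in> carrier G" for b and q :: rat
    using that by (simp add: rat_tensor_free_def)
  have diff_closed: "x - y \<in> carrier ?F" if "x \<in> carrier ?F" "y \<in> carrier ?F" for x y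
    using that keys_diff[of x y] by (auto simp: rat_tensor_free_def)
  have diff: "f (x - y) = f x \<otimes> inv (f y)"
    if "scales f M" "x \<in> carrier ?F" "y \<in> carrier ?F" for f M x y
  proof -
    interpret f: group_hom ?F G f
      using that F by (intro group_hom.intro group_hom_axioms.intro) (auto simp: scales_def)
    have "x - y = x \<otimes>\<^bsub>?F\<^esub> inv\<^bsub>?F\<^esub> y" using that by (simp add: rat_tensor_free_def)
    then show ?thesis using that by simp
  qed
  have commute: "u \<otimes> v \<otimes> inv u \<otimes> inv v = \<one>" if "u \<in> carrier G" "v \<in> carrier G" for u v
  proof -
    have "u \<otimes> v \<otimes> inv u \<otimes> inv v = (u \<otimes> v) \<otimes> inv (u \<otimes> v)"
      using that by (simp add: inv_mult m_assoc)
    then show ?thesis using that by simp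
  qed
  have rel: "\<exists>N>0. \<forall>M f. N dvd M \<longrightarrow> scales f M \<longrightarrow> f x = \<one>" if x: "x \<in> rat_tensor_rels G" for x
  proof -
    consider (left) b c q where "b \<in> carrier G" "c \<in> carrier G"
        "x = frag_of (b \<otimes> c, q) - frag_of (b, q) - frag_of (c, q)"
      | (right) b p q where "b \<in> carrier G" "x = frag_of (b, p + q) - frag_of (b, p) - frag_of (b, q)"
      using x unfolding rat_tensor_rels_def by blast
    then show ?thesis
    proof cases
      case left
      have "f x = \<one>" if f: "scales f M" for f M
      proof -
        let ?k = "\<lfloor>of_int M * q\<rfloor>"
        have "f x = (b \<otimes> c) [^] ?k \<otimes> inv (b [^] ?k) \<otimes> inv (c [^] ?k)"
          using left f by (simp add: diff[OF f] diff_closed gen) (simp add: scales_def)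
        then show ?thesis
          using left commute[of "b [^] ?k" "c [^] ?k"] by (simp add: int_pow_distrib)
      qed
      then show ?thesis by (intro exI[of _ 1]) auto
    next
      case right
      obtain N N' k k' where N: "N > 0" "N' > 0" "of_int N * p = of_int k" "of_int N' * q = of_int k'"
        using ex_rat_denominator by metis
      have "f x = \<one>" if f: "scales f M" and M: "N * N' dvd M" for f M
      proof -
        obtain l where l: "M = N * N' * l" using M by blast
        have Mp: "of_int M * p = of_int (N' * l * k)" "of_int M * q = of_int (N * l * k')"
          using N(3,4) by (simp_all add: l algebra_simps flip: N(3,4))
        then have Mpq: "of_int M * (p + q) = of_int (N' * l * k + N * l * k')"
          by (simp add: distrib_left)
        have "f x = b [^] (N' * l * k + N * l * k') \<otimes> inv (b [^] (N' * l * k)) \<otimes> inv (b [^] (N * l * k'))"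
          using right f Mp Mpq by (simp add: diff[OF f] diff_closed gen del: of_int_mult of_int_add)
            (simp add: scales_def del: of_int_mult of_int_add)
        then show ?thesis
          using right commute[of "b [^] (N' * l * k)" "b [^] (N * l * k')"] by (simp add: int_pow_mult)
      qed
      then show ?thesis using N by (intro exI[of _ "N * N'"]) auto
    qed
  qed
  have hom: "group_hom ?F G f" if "scales f M" for f M
    using that F is_group by (auto simp: scales_def group_hom_def group_hom_axioms_def)
  have rels_F: "rat_tensor_rels G \<subseteq> carrier ?F"
    by (rule rat_tensor_rels_carrier[OF is_group])
  have "\<exists>N>0. \<forall>M f. N dvd M \<longrightarrow> scales f M \<longrightarrow> f x = \<one>" if "x \<in> rat_tensor_kernel G" for x
    using that unfolding rat_tensor_kernel_def
  proof (induction rule: generate.induct)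
    case one
    show ?case using group_hom.hom_one[OF hom] by (intro exI[of _ 1]) auto
  next
    case (incl x)
    then show ?case by (rule rel)
  next
    case (inv x)
    then obtain N where N: "N > 0" "\<forall>M f. N dvd M \<longrightarrow> scales f M \<longrightarrow> f x = \<one>"
      using rel by blast
    have "f (inv\<^bsub>?F\<^esub> x) = \<one>" if "N dvd M" "scales f M" for M f
    proof -
      have "f x = \<one>" using that N(2) by blast
      moreover have "x \<in> carrier ?F" using inv rels_F by blast
      ultimately show ?thesis using group_hom.hom_inv[OF hom[OF that(2)], of x] by simp
    qed
    then show ?case using N(1) by blast
  next
    case (eng x y)
    then obtain N N' where N: "N > 0" "N' > 0" "\<forall>M f. N dvd M \<longrightarrow> scales f M \<longrightarrow> f x = \<one>"
      "\<forall>M f. N' dvd M \<longrightarrow> scales f M \<longrightarrow> f y = \<one>"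
      by blast
    have carr: "x \<in> carrier ?F" "y \<in> carrier ?F"
      using eng(1,2) group.generate_in_carrier[OF F rels_F] by auto
    have "f (x \<otimes>\<^bsub>?F\<^esub> y) = \<one>" if "N * N' dvd M" "scales f M" for M f
    proof -
      have "N dvd M" "N' dvd M"
        using that(1) by (rule dvd_mult_left, rule dvd_mult_right[of N])
      then have "f x = \<one>" "f y = \<one>" using that(2) N(3,4) by blast+
      then show ?thesis using group_hom.hom_mult[OF hom[OF that(2)] carr] by simp
    qed
    then show ?case using N(1,2) by (intro exI[of _ "N * N'"]) auto
  qed
  then obtain N where N: "N > 0" "\<And>M f. N dvd M \<Longrightarrow> scales f M \<Longrightarrow> f (frag_of (a, 1)) = \<one>"
    using ker by blast
  obtain f where f: "scales f N" using ex by blast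
  then have "f (frag_of (a, 1)) = a [^] N" using a by (simp add: scales_def)
  then show ?thesis using N(2)[OF dvd_refl f] N(1) by auto
qed

text \<open>For a subgroup \<open>L\<close> let \<open>W L\<close> be the set of tensors with a positive integral multiple of the form
  \<open>l \<otimes> 1\<close> with \<open>l \<in> L\<close>; clearing denominators shows that it is a linear subspace. The subspace
  \<open>W (carrier G)\<close> contains all \<open>a \<otimes> 1\<close>, hence all \<open>a \<otimes> q\<close>, and so is everything. So every
  vector \<open>b\<close> of a basis has a multiple \<open>a b \<otimes> 1\<close>. If \<open>L\<close> is generated by the elements \<open>a b\<close>, then \<open>W L\<close> contains the basis and is again
  everything, which for tensors \<open>g \<otimes> 1\<close> means that \<open>g\<close> has a power in \<open>L\<close>, up to torsion.\<close>

lemma (in comm_group) torsion_over_finite_generation: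
  assumes dim: "vdim (class_ring :: rat ring) (rat_tensor G) = enat r"
  shows "\<exists>X. finite X \<and> card X \<le> r \<and> X \<subseteq> carrier G \<and>
    (\<forall>a\<in>carrier G. \<exists>N>0. a [^] (N :: int) \<in> generate G X)"
proof -
  let ?K = "class_ring :: rat ring" and ?V = "rat_tensor G"
  let ?F = "rat_tensor_free G" and ?N = "rat_tensor_kernel G" and ?e = "unit_tensor G"
  interpret V: vectorspace ?K ?V by (rule vectorspace_rat_tensor[OF is_group])
  interpret F: group ?F by (simp add: rat_tensor_free_def)
  interpret N: subgroup ?N ?F by (rule rat_tensor_kernel_subgroup[OF is_group])
  have gen: "frag_of (a, q) \<in> carrier ?F" if "a \<in> carrier G" for a and q :: rat
    using that by (simp add: rat_tensor_free_def)
  have coset_closed: "?N #>\<^bsub>?F\<^esub> x \<in> carrier ?V" if "x \<in> carrier ?F" for x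
    using that by (auto simp: rat_tensor_simps carrier_FactGroup)
  have e_closed: "?e a \<in> carrier ?V" if "a \<in> carrier G" for a
    using coset_closed[OF gen[OF that]] .
  have coset_eq: "?N #>\<^bsub>?F\<^esub> x = ?N #>\<^bsub>?F\<^esub> y"
    if "x \<in> carrier ?F" "y \<in> carrier ?F" "x - y \<in> ?N" for x y
  proof -
    have "x = (x - y) \<otimes>\<^bsub>?F\<^esub> y" by (simp add: rat_tensor_free_def)
    then have "x \<in> ?N #>\<^bsub>?F\<^esub> y" using that(3) unfolding r_coset_def by blast
    then show ?thesis using F.repr_independence[OF _ that(2) N.subgroup_axioms] by simp
  qed
  have zero: "\<zero>\<^bsub>?V\<^esub> = ?N" by (simp add: rat_tensor_simps)
  have add_closed: "x + y \<in> carrier ?F" if "x \<in> carrier ?F" "y \<in> carrier ?F" for x y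
    using F.m_closed[OF that] by (simp add: rat_tensor_free_def)
  have e_mult: "?e (a \<otimes> b) = ?e a \<oplus>\<^bsub>?V\<^esub> ?e b" if "a \<in> carrier G" "b \<in> carrier G" for a b
  proof -
    have "frag_of (a \<otimes> b, 1) - frag_of (a, 1) - frag_of (b, 1) \<in> rat_tensor_rels G"
      using that unfolding rat_tensor_rels_def by blast
    then have "frag_of (a \<otimes> b, 1) - (frag_of (a, 1) + frag_of (b, 1)) \<in> ?N"
      unfolding rat_tensor_kernel_def by (intro generate.incl) (simp add: diff_diff_eq)
    then have "?e (a \<otimes> b) = ?N #>\<^bsub>?F\<^esub> (frag_of (a, 1) + frag_of (b, 1))"
      using that by (intro coset_eq gen add_closed m_closed)
    then show ?thesis using that rat_tensor_add_coset[OF is_group] gen by simp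
  qed
  have smult_e: "q \<odot>\<^bsub>?V\<^esub> ?e a = ?N #>\<^bsub>?F\<^esub> frag_of (a, q)" if "a \<in> carrier G" for a q
    using rat_tensor_smult_coset[OF is_group gen[OF that]] by (simp add: rat_tensor_scale_def)
  have e_one: "?e \<one> = \<zero>\<^bsub>?V\<^esub>"
  proof -
    have "?e \<one> \<oplus>\<^bsub>?V\<^esub> ?e \<one> = ?e \<one>" using e_mult[of \<one> \<one>] by simp
    then show ?thesis using V.M.add.l_cancel_one[OF e_closed e_closed] by simp
  qed
  have smult_add: "(p + q) \<odot>\<^bsub>?V\<^esub> x = p \<odot>\<^bsub>?V\<^esub> x \<oplus>\<^bsub>?V\<^esub> q \<odot>\<^bsub>?V\<^esub> x"
    if "x \<in> carrier ?V" for p q x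
    using V.smult_l_distr[of p q x] that by simp
  have smult_mult: "(p * q) \<odot>\<^bsub>?V\<^esub> x = p \<odot>\<^bsub>?V\<^esub> (q \<odot>\<^bsub>?V\<^esub> x)"
    if "x \<in> carrier ?V" for p q x
    using V.smult_assoc1[of p q x] that by simp
  have smult_one: "1 \<odot>\<^bsub>?V\<^esub> x = x" if "x \<in> carrier ?V" for x
    using V.smult_one[of x] that by simp
  have smult_closed: "q \<odot>\<^bsub>?V\<^esub> x \<in> carrier ?V" if "x \<in> carrier ?V" for q x
    using V.smult_closed[of q x] that by simp
  have e_pow: "of_int k \<odot>\<^bsub>?V\<^esub> ?e a = ?e (a [^] k)" if a: "a \<in> carrier G" for a and k :: int
  proof (induction k rule: int_induct[where k = 0])
    case base
    have "0 \<odot>\<^bsub>?V\<^esub> ?e a = \<zero>\<^bsub>?V\<^esub>" using V.smult_l_null[OF e_closed[OF a]] by simp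
    then show ?case using e_one by simp
  next
    case (step1 k)
    have "of_int (k + 1) \<odot>\<^bsub>?V\<^esub> ?e a = ?e (a [^] k) \<oplus>\<^bsub>?V\<^esub> ?e a"
      using smult_add[OF e_closed[OF a], of "of_int k" 1] smult_one[OF e_closed[OF a]] step1 by simp
    also have "\<dots> = ?e (a [^] (k + 1))" using a e_mult[of "a [^] k" a] by (simp add: int_pow_mult)
    finally show ?case .
  next
    case (step2 k)
    have "of_int (k - 1) \<odot>\<^bsub>?V\<^esub> ?e a \<oplus>\<^bsub>?V\<^esub> ?e a = ?e (a [^] k)"
      using smult_add[OF e_closed[OF a], of "of_int (k - 1)" 1] smult_one[OF e_closed[OF a]] step2 by simp
    also have "\<dots> = ?e (a [^] (k - 1)) \<oplus>\<^bsub>?V\<^esub> ?e a"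
      using a e_mult[of "a [^] (k - 1)" a] int_pow_mult[OF a, of "k - 1" 1] by simp
    finally show ?case
      using V.M.add.right_cancel[OF e_closed[OF a] smult_closed[OF e_closed[OF a]] e_closed] a by simp
  qed
  have e_eqD: "\<exists>M>0. a [^] (M :: int) = b [^] M"
    if ab: "a \<in> carrier G" "b \<in> carrier G" and eq: "?e a = ?e b" for a b
  proof -
    let ?c = "a \<otimes> inv b"
    have "?e ?c \<oplus>\<^bsub>?V\<^esub> ?e b = ?e b" using e_mult[of ?c b] ab eq by (simp add: m_assoc)
    then have "?e ?c = \<zero>\<^bsub>?V\<^esub>" using V.M.add.r_cancel_one[OF e_closed e_closed] ab by simp
    then have "frag_of (?c, 1) \<in> ?N"
      using F.rcos_self[OF gen[of ?c 1] N.subgroup_axioms] ab zero by simp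
    then obtain M where M: "M > 0" "?c [^] (M :: int) = \<one>"
      using rat_tensor_kernel_torsion[of ?c] ab by auto
    have "a [^] M = (?c \<otimes> b) [^] M" using ab by (simp add: m_assoc)
    also have "\<dots> = b [^] M" using int_pow_distrib[of ?c b M] ab M(2) by simp
    finally show ?thesis using M(1) by blast
  qed
  define W where "W L = {x \<in> carrier ?V. \<exists>N>0. \<exists>l\<in>L. of_int (N :: int) \<odot>\<^bsub>?V\<^esub> x = ?e l}" for L
  have W_I: "x \<in> W L"
    if "of_int N \<odot>\<^bsub>?V\<^esub> x = ?e l" "N > 0" "l \<in> L" "x \<in> carrier ?V" for x N l L
    unfolding W_def using that by (intro CollectI conjI exI[of _ N] bexI[of _ l])
  have W: "submodule ?K (W L) ?V" if "subgroup L G" for L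
  proof -
    interpret L: subgroup L G by fact
    have L_pow: "l [^] (k :: int) \<in> L" if "l \<in> L" for l k
      using subgroup_int_pow_closed[OF \<open>subgroup L G\<close> that] .
    show ?thesis
    proof
      show "W L \<subseteq> carrier ?V" by (auto simp: W_def)
      have "of_int 1 \<odot>\<^bsub>?V\<^esub> \<zero>\<^bsub>?V\<^esub> = ?e \<one>" using e_one smult_one[of "\<zero>\<^bsub>?V\<^esub>"] by simp
      then show "\<zero>\<^bsub>?V\<^esub> \<in> W L"
        by (rule W_I) simp_all
    next
      fix x y assume "x \<in> W L" "y \<in> W L"
      then obtain N l N' l' where xy: "x \<in> carrier ?V" "y \<in> carrier ?V" "N > 0" "N' > 0" "l \<in> L" "l' \<in> L"
        "of_int N \<odot>\<^bsub>?V\<^esub> x = ?e l" "of_int N' \<odot>\<^bsub>?V\<^esub> y = ?e l'"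
        unfolding W_def by blast
      have "of_int (N * N') \<odot>\<^bsub>?V\<^esub> x = ?e (l [^] N')"
        using smult_mult[of x "of_int N'" "of_int N"] xy e_pow[of l N'] by (simp add: mult.commute)
      moreover have "of_int (N * N') \<odot>\<^bsub>?V\<^esub> y = ?e (l' [^] N)"
        using smult_mult[of y "of_int N" "of_int N'"] xy e_pow[of l' N] by simp
      ultimately have "of_int (N * N') \<odot>\<^bsub>?V\<^esub> (x \<oplus>\<^bsub>?V\<^esub> y) = ?e (l [^] N' \<otimes> l' [^] N)"
        using xy V.smult_r_distr[of "of_int (N * N')" x y] e_mult[of "l [^] N'" "l' [^] N"] by simp
      then show "x \<oplus>\<^bsub>?V\<^esub> y \<in> W L" by (rule W_I) (use xy L_pow in simp_all)
    next
      fix q :: rat and x assume "x \<in> W L"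
      then obtain N l where x: "x \<in> carrier ?V" "N > 0" "l \<in> L" "of_int N \<odot>\<^bsub>?V\<^esub> x = ?e l"
        unfolding W_def by blast
      obtain M k where M: "M > 0" "of_int M * q = of_int k" using ex_rat_denominator by blast
      have "of_int (M * N) \<odot>\<^bsub>?V\<^esub> (q \<odot>\<^bsub>?V\<^esub> x) = (of_int (M * N) * q) \<odot>\<^bsub>?V\<^esub> x"
        using smult_mult x by simp
      also have "of_int (M * N) * q = of_int k * of_int N" by (simp flip: M(2))
      also have "(of_int k * of_int N) \<odot>\<^bsub>?V\<^esub> x = ?e (l [^] k)"
        using smult_mult[of x "of_int k" "of_int N"] x e_pow[of l k] by simp
      finally have "of_int (M * N) \<odot>\<^bsub>?V\<^esub> (q \<odot>\<^bsub>?V\<^esub> x) = ?e (l [^] k)" .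
      then show "q \<odot>\<^bsub>?V\<^esub> x \<in> W L" by (rule W_I) (use x M L_pow smult_closed in simp_all)
    qed
  qed
  have e_W: "?e l \<in> W L" if "l \<in> L" "l \<in> carrier G" for l L
  proof -
    have "of_int 1 \<odot>\<^bsub>?V\<^esub> ?e l = ?e l" using smult_one[OF e_closed] that by simp
    then show ?thesis by (rule W_I) (use that e_closed in simp_all)
  qed
  have all: "C \<in> W (carrier G)" if C: "C \<in> carrier ?V" for C
  proof -
    interpret W: submodule ?K "W (carrier G)" ?V by (rule W[OF subgroup_self])
    obtain x where x: "x \<in> carrier ?F" "C = ?N #>\<^bsub>?F\<^esub> x" using C by (rule rat_tensor_cosetE)
    then have "Poly_Mapping.keys x \<subseteq> carrier G \<times> UNIV" by (simp add: rat_tensor_free_def)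
    then have "?N #>\<^bsub>?F\<^esub> x \<in> W (carrier G)"
    proof (rule free_Abelian_group_induct)
      have "?N #>\<^bsub>?F\<^esub> 0 = \<zero>\<^bsub>?V\<^esub>"
        using F.coset_mult_one[OF N.subset] zero by (simp add: rat_tensor_free_def)
      then show "?N #>\<^bsub>?F\<^esub> 0 \<in> W (carrier G)" by simp
    next
      let ?c = "\<lambda>x. ?N #>\<^bsub>?F\<^esub> x"
      fix x y
      assume keys: "Poly_Mapping.keys x \<subseteq> carrier G \<times> UNIV" "Poly_Mapping.keys y \<subseteq> carrier G \<times> UNIV"
        and IH: "?c x \<in> W (carrier G)" "?c y \<in> W (carrier G)"
      have carr: "x \<in> carrier ?F" "y \<in> carrier ?F" "x - y \<in> carrier ?F"
        using keys keys_diff[of x y] by (auto simp: rat_tensor_free_def)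
      have c: "?c x \<in> carrier ?V" "?c y \<in> carrier ?V" "?c (x - y) \<in> carrier ?V"
        using carr coset_closed by blast+
      have "?c (x - y) \<oplus>\<^bsub>?V\<^esub> ?c y = ?c x"
        using rat_tensor_add_coset[OF is_group carr(3,2)] by simp
      then have "?c (x - y) = ?c x \<ominus>\<^bsub>?V\<^esub> ?c y"
        using c by (metis V.M.add.inv_solve_right a_minus_def)
      also have "\<dots> = ?c x \<oplus>\<^bsub>?V\<^esub> (- 1) \<odot>\<^bsub>?V\<^esub> ?c y"
      proof -
        have "(- 1) \<odot>\<^bsub>?V\<^esub> ?c y \<oplus>\<^bsub>?V\<^esub> ?c y = \<zero>\<^bsub>?V\<^esub>"
          using smult_add[OF c(2), of "- 1" 1] smult_one[OF c(2)] V.smult_l_null[OF c(2)] by simp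
        then have "\<ominus>\<^bsub>?V\<^esub> ?c y = (- 1) \<odot>\<^bsub>?V\<^esub> ?c y"
          using c smult_closed by (intro V.M.minus_equality)
        then show ?thesis by (simp add: a_minus_def)
      qed
      also have "\<dots> \<in> W (carrier G)"
        using IH by (intro W.m_closed W.smult_closed) simp_all
      finally show "?c (x - y) \<in> W (carrier G)" .
    next
      fix u assume "u \<in> carrier G \<times> (UNIV :: rat set)"
      then obtain a q where u: "u = (a, q)" "a \<in> carrier G" by auto
      have "q \<odot>\<^bsub>?V\<^esub> ?e a \<in> W (carrier G)"
        by (rule W.smult_closed[OF _ e_W[OF u(2) u(2)]]) simp
      then show "?N #>\<^bsub>?F\<^esub> frag_of u \<in> W (carrier G)"
        using smult_e[OF u(2), of q] u(1) by simp
    qed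
    then show ?thesis using x by simp
  qed
  have fd: "V.fin_dim" and r: "V.dim = r" using dim by (auto simp: vdim_def split: if_splits)
  obtain \<beta> where \<beta>: "finite \<beta>" "V.basis \<beta>" using V.finite_basis_exists[OF fd] by blast
  have \<beta>V: "\<beta> \<subseteq> carrier ?V" "V.span \<beta> = carrier ?V" using \<beta>(2) by (auto simp: V.basis_def)
  have "\<forall>b\<in>\<beta>. \<exists>a\<in>carrier G. \<exists>N>0. of_int (N :: int) \<odot>\<^bsub>?V\<^esub> b = ?e a"
    using all \<beta>V(1) unfolding W_def by blast
  then obtain a where a: "\<forall>b\<in>\<beta>. a b \<in> carrier G \<and> (\<exists>N>0. of_int (N :: int) \<odot>\<^bsub>?V\<^esub> b = ?e (a b))"
    by metis
  define X where "X = a ` \<beta>"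
  have X: "finite X" "card X \<le> r" "X \<subseteq> carrier G"
    using \<beta>(1) a V.dim_basis[OF \<beta>] r card_image_le[OF \<beta>(1), of a] by (auto simp: X_def)
  have L: "subgroup (generate G X) G" by (rule generate_is_subgroup[OF X(3)])
  have "\<beta> \<subseteq> W (generate G X)"
  proof
    fix b assume b: "b \<in> \<beta>"
    then obtain N where "N > 0" "of_int (N :: int) \<odot>\<^bsub>?V\<^esub> b = ?e (a b)" using a by blast
    then show "b \<in> W (generate G X)"
      using b \<beta>V(1) by (intro W_I[of N b "a b"] generate.incl) (auto simp: X_def)
  qed
  from V.span_is_subset[OF this W[OF L]] have V_W: "carrier ?V \<subseteq> W (generate G X)"
    unfolding \<beta>V(2) .
  have "\<exists>N>0. g [^] (N :: int) \<in> generate G X" if g: "g \<in> carrier G" for g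
  proof -
    have "?e g \<in> W (generate G X)" using V_W e_closed[OF g] by blast
    then obtain N l where N: "N > 0" "l \<in> generate G X" "of_int (N :: int) \<odot>\<^bsub>?V\<^esub> ?e g = ?e l"
      unfolding W_def by blast
    have l: "l \<in> carrier G" using N(2) generate_in_carrier[OF X(3)] by blast
    have "?e (g [^] N) = ?e l" using N(3) e_pow[OF g] by simp
    then obtain M where M: "M > 0" "(g [^] N) [^] M = l [^] (M :: int)"
      using e_eqD[of "g [^] N" l] g l by auto
    then have "g [^] (N * M) \<in> generate G X"
      using subgroup_int_pow_closed[OF L N(2), of M] g by (simp add: int_pow_pow)
    then show ?thesis using N(1) M(1) by (intro exI[of _ "N * M"]) simp
  qed
  then show ?thesis using X by blast
qed

section \<open>Dimension of abelian and solvable groups\<close>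

lemma (in comm_group) generate_insert_subset:
  assumes x: "x \<in> carrier G" and S: "S \<subseteq> carrier G"
  shows "generate G (insert x S) \<subseteq> generate G {x} <#> generate G S"
proof (rule generate_subgroup_incl)
  have sub: "subgroup (generate G {x}) G" "subgroup (generate G S) G"
    using x S by (auto intro: generate_is_subgroup)
  then show "subgroup (generate G {x} <#> generate G S) G" by (rule mult_subgroups)
  have "x \<otimes> \<one> \<in> generate G {x} <#> generate G S"
    unfolding set_mult_def using generate.incl[of x "{x}" G] generate.one[of G S] by blast
  moreover have "\<one> \<otimes> s \<in> generate G {x} <#> generate G S" if "s \<in> S" for s
    unfolding set_mult_def using generate.one[of G "{x}"] generate.incl[OF that, of G] by blast
  ultimately show "insert x S \<subseteq> generate G {x} <#> generate G S"
    using x S by (auto simp: subset_eq)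
qed

lemma (in comm_group) torsion_locally_finite:
  assumes torsion: "\<And>x. x \<in> carrier G \<Longrightarrow> \<exists>N>0. x [^] (N :: int) = \<one>"
    and S: "finite S" "S \<subseteq> carrier G"
  shows "finite (generate G S)"
  using S
proof (induction S rule: finite_induct)
  case empty
  then show ?case by (simp add: generate_empty)
next
  case (insert x S)
  have "\<exists>i. i \<noteq> 0 \<and> x [^] (i :: int) = \<one>"
    using torsion[of x] insert.prems by (metis insert_subset less_irrefl)
  then have "finite (carrier (subgroup_generated G {x}))"
    using finite_cyclic_subgroup_int[of x] insert.prems by simp
  then have "finite (generate G {x})"
    using insert.prems by (simp add: carrier_subgroup_generated)
  then have "finite (generate G {x} <#> generate G S)"
    using insert by (simp add: set_mult_def)
  then show ?case
    using generate_insert_subset[of x S] insert.prems finite_subset by blast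
qed

text \<open>Each new generator \<open>x\<close> adds at most one to the dimension, because modulo the
  subgroup generated so far the enlarged subgroup is cyclic, generated by the class of \<open>x\<close>.\<close>

lemma (in comm_group) generate_asdim_le_card:
  assumes "finite X" "X \<subseteq> carrier G"
  shows "group_coarse_asdim_le (G\<lparr>carrier := generate G X\<rparr>) (card X)"
  using assms
proof (induction X rule: finite_induct)
  case empty
  let ?T = "G\<lparr>carrier := generate G {}\<rparr>"
  interpret T: group ?T by (intro subgroup_imp_group generate_is_subgroup) simp
  show ?case using T.finite_asdim_0 by (simp add: generate_empty)
next
  case (insert x X)
  let ?A = "generate G (insert x X)" and ?B = "generate G X"
  let ?A' = "G\<lparr>carrier := ?A\<rparr>"
  have A: "subgroup ?A G" and B: "subgroup ?B G"
    using insert.prems by (auto intro: generate_is_subgroup)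
  interpret A: comm_group ?A'
    by (rule group.group_comm_groupI[OF subgroup_imp_group[OF A]])
      (use subgroup.subset[OF A] m_comm in auto)
  have X_A: "insert x X \<subseteq> ?A" by (auto intro: generate.incl)
  have "?B \<subseteq> ?A" by (rule mono_generate) auto
  then have "?B \<lhd> ?A'"
    using A.normal_iff_subgroup subgroup_incl[OF B A] by simp
  then interpret B: normal ?B ?A' .
  let ?Q = "?A' Mod ?B"
  interpret q: group_hom ?A' ?Q "\<lambda>a. ?B #>\<^bsub>?A'\<^esub> a"
    by (intro group_hom.intro group_hom_axioms.intro A.is_group B.factorgroup_is_group B.r_coset_hom_Mod)
  let ?q = "\<lambda>a. ?B #>\<^bsub>?A'\<^esub> a"
  have qx: "?q x \<in> carrier ?Q" using X_A by (intro q.hom_closed) simp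
  have "carrier ?Q = ?q ` generate ?A' (insert x X)"
    using generate_consistent[OF X_A A] by (simp add: carrier_FactGroup)
  also have "\<dots> = generate ?Q (?q ` insert x X)"
    using q.generate_img[of "insert x X"] X_A by simp
  also have "\<dots> \<subseteq> generate ?Q {?q x}"
  proof (rule q.H.generate_subgroup_incl)
    show "subgroup (generate ?Q {?q x}) ?Q" using qx by (intro q.H.generate_is_subgroup) simp
    have "?q y = \<one>\<^bsub>?Q\<^esub>" if "y \<in> X" for y
      using A.coset_join2[OF _ B.subgroup_axioms, of y] generate.incl[OF that, of G] \<open>?B \<subseteq> ?A\<close> by auto
    then show "?q ` insert x X \<subseteq> generate ?Q {?q x}"
      using generate.incl[of "?q x" "{?q x}" ?Q] generate.one[of ?Q "{?q x}"] by (auto simp del: one_FactGroup)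
  qed
  finally have "carrier ?Q = generate ?Q {?q x}"
    using q.H.generate_incl[of "{?q x}"] qx by auto
  then have "group_coarse_asdim_le ?Q 1" by (rule q.H.cyclic_asdim_1[OF qx])
  then have "group_coarse_asdim_le ?A' (card X + 1)"
    using insert by (intro A.asdim_extension_normal[OF B.normal_axioms]) simp_all
  then show ?case using insert by simp
qed

text \<open>The group is an extension of a torsion abelian group, which has dimension 0, by a subgroup with
  at most \<open>r\<close> generators.\<close>

theorem (in comm_group) asdim_le_rank:
  assumes dim: "vdim (class_ring :: rat ring) (rat_tensor G) = enat r"
  shows "group_coarse_asdim_le G r"
proof -
  obtain X where X: "finite X" "card X \<le> r" "X \<subseteq> carrier G"
    "\<forall>a\<in>carrier G. \<exists>N>0. a [^] (N :: int) \<in> generate G X"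
    using torsion_over_finite_generation[OF dim] by blast
  let ?L = "generate G X"
  have L: "subgroup ?L G" by (rule generate_is_subgroup[OF X(3)])
  then have "?L \<lhd> G" by (simp add: normal_iff_subgroup)
  then interpret L: normal ?L G .
  interpret Q: comm_group "G Mod ?L" by (rule abelian_FactGroup[OF L])
  have "\<exists>N>0. C [^]\<^bsub>G Mod ?L\<^esub> (N :: int) = \<one>\<^bsub>G Mod ?L\<^esub>" if C: "C \<in> carrier (G Mod ?L)" for C
  proof -
    obtain a where a: "a \<in> carrier G" "C = ?L #> a" using C by (auto simp: carrier_FactGroup)
    then obtain N where N: "N > 0" "a [^] (N :: int) \<in> ?L" using X(4) by blast
    have "C [^]\<^bsub>G Mod ?L\<^esub> N = ?L #> (a [^] N)" using a L.FactGroup_int_pow by simp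
    also have "\<dots> = \<one>\<^bsub>G Mod ?L\<^esub>" using coset_join2[OF _ L N(2)] a by simp
    finally show ?thesis using N(1) by blast
  qed
  then have "group_coarse_asdim_le (G Mod ?L) 0"
    by (intro Q.locally_finite_asdim_0 Q.torsion_locally_finite)
  then have "group_coarse_asdim_le G (card X + 0)"
    using asdim_extension_normal[OF \<open>?L \<lhd> G\<close> generate_asdim_le_card[OF X(1,3)]] by blast
  then show ?thesis
    using X(2) unfolding group_coarse_asdim_le_def by (auto intro: coarse_asdim_le_mono)
qed

lemma (in group) derived_series_asdim_le:
  assumes triv: "derived_series G n = {\<one>}"
    and rank: "\<And>j. j < n \<Longrightarrow> vdim (class_ring :: rat ring)
      (rat_tensor (G\<lparr>carrier := derived_series G j\<rparr> Mod derived_series G (Suc j))) = enat (r j)"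
    and "i \<le> n"
  shows "group_coarse_asdim_le (G\<lparr>carrier := derived_series G i\<rparr>) (\<Sum>j=i..<n. r j)"
  using \<open>i \<le> n\<close>
proof (induction i rule: inc_induct)
  case base
  interpret T: group "G\<lparr>carrier := {\<one>}\<rparr>"
    by (rule subgroup_imp_group[OF triv_subgroup])
  show ?case using T.finite_asdim_0 by (simp add: triv)
next
  case (step i)
  let ?D = "derived_series G i" and ?E = "derived_series G (Suc i)"
  have D: "subgroup ?D G"
    unfolding derived_series_def by (rule exp_of_derived_is_subgroup[OF subgroup_self])
  have E: "?E = derived G ?D" by (simp add: derived_series_def)
  interpret D: group "G\<lparr>carrier := ?D\<rparr>" by (rule subgroup_imp_group[OF D])
  interpret Q: comm_group "G\<lparr>carrier := ?D\<rparr> Mod ?E"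
    unfolding E by (rule derived_quot_of_subgroup_is_comm_group[OF D])
  have "group_coarse_asdim_le (G\<lparr>carrier := ?D\<rparr> Mod ?E) (r i)"
    by (rule Q.asdim_le_rank[OF rank[OF step.hyps(2)]])
  moreover have "?E \<lhd> G\<lparr>carrier := ?D\<rparr>"
    unfolding E by (rule derived_subgroup_is_normal[OF D])
  ultimately have "group_coarse_asdim_le (G\<lparr>carrier := ?D\<rparr>) ((\<Sum>j=Suc i..<n. r j) + r i)"
    using step.IH by (intro D.asdim_extension_normal) simp_all
  then show ?case using step.hyps by (simp add: sum.atLeast_Suc_lessThan add.commute)
qed

text \<open>Balls are finite, so \<open>d x y \<le> r\<close> is a controlled relation; conversely a controlled relation has
  finitely many differences and \<open>d\<close> is bounded on it, by left invariance.\<close>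

lemma coarse_asdim_imp_asdim_le:
  assumes G: "group G" and d: "proper_left_invariant_metric G d"
    and dim: "group_coarse_asdim_le G n"
  shows "asdim_le (carrier G) d n"
  unfolding asdim_le_def
proof (intro allI impI)
  interpret group G by fact
  interpret D: Metric_space "carrier G" d
    using d by (simp add: proper_left_invariant_metric_def)
  have shift: "d \<one>\<^bsub>G\<^esub> (inv\<^bsub>G\<^esub> x \<otimes>\<^bsub>G\<^esub> y) = d x y" if "x \<in> carrier G" "y \<in> carrier G" for x y
  proof -
    have "d (inv\<^bsub>G\<^esub> x \<otimes>\<^bsub>G\<^esub> x) (inv\<^bsub>G\<^esub> x \<otimes>\<^bsub>G\<^esub> y) = d x y"
      using d that unfolding proper_left_invariant_metric_def by blast
    then show ?thesis using that by simp
  qed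
  fix r :: real assume "r > 0"
  define E where "E = {(x, y). x \<in> carrier G \<and> y \<in> carrier G \<and> d x y \<le> r}"
  have "finite (D.mcball \<one>\<^bsub>G\<^esub> r)"
    using d by (simp add: proper_left_invariant_metric_def)
  then have "E \<in> group_coarse G"
    by (rule group_coarseI) (use shift in \<open>auto simp: E_def\<close>)
  then obtain F X where F: "F \<in> group_coarse G" and X: "\<forall>x\<in>carrier G. \<exists>i\<le>n. x \<in> X i"
    "\<forall>i\<le>n. splits E F (X i)"
    using dim unfolding group_coarse_asdim_le_def coarse_asdim_le_def by blast
  obtain T where T: "finite T"
    "\<forall>(x, y)\<in>F. x \<in> carrier G \<and> y \<in> carrier G \<and> inv\<^bsub>G\<^esub> x \<otimes>\<^bsub>G\<^esub> y \<in> T"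
    using F by (rule group_coarseE)
  define R where "R = Max (insert 0 (d \<one>\<^bsub>G\<^esub> ` T))"
  have R: "d x y \<le> R" if "(x, y) \<in> F" for x y
  proof -
    have xy: "x \<in> carrier G" "y \<in> carrier G" "inv\<^bsub>G\<^esub> x \<otimes>\<^bsub>G\<^esub> y \<in> T" using T(2) that by auto
    have "d \<one>\<^bsub>G\<^esub> (inv\<^bsub>G\<^esub> x \<otimes>\<^bsub>G\<^esub> y) \<le> R" unfolding R_def using T(1) xy(3) by (intro Max_ge) auto
    then show ?thesis using shift xy by simp
  qed
  have "\<forall>i. \<exists>f :: 'a \<Rightarrow> 'a set. i \<le> n \<longrightarrow> labels E F (X i) f"
    using X(2) unfolding splits_def by blast
  then obtain f :: "nat \<Rightarrow> 'a \<Rightarrow> 'a set" where "\<And>i. i \<le> n \<Longrightarrow> labels E F (X i) (f i)"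
    by metis
  note f = labelsD[OF this]
  define piece where "piece i x = {y \<in> X i \<inter> carrier G. f i y = f i x}" for i x
  define \<U> where "\<U> i = piece i ` (X i \<inter> carrier G)" for i
  have "(\<Union>i\<le>n. \<Union> (\<U> i)) = carrier G"
  proof
    show "carrier G \<subseteq> (\<Union>i\<le>n. \<Union> (\<U> i))"
    proof
      fix x assume x: "x \<in> carrier G"
      then obtain i where i: "i \<le> n" "x \<in> X i" using X(1) by blast
      then have "x \<in> piece i x" "piece i x \<in> \<U> i" using x by (simp_all add: piece_def \<U>_def)
      then show "x \<in> (\<Union>i\<le>n. \<Union> (\<U> i))" using i by blast
    qed
  qed (auto simp: \<U>_def piece_def)
  moreover have "bounded_family d R (\<U> i)" if "i \<le> n" for i
    using f(2)[OF that] R by (auto simp: bounded_family_def \<U>_def piece_def)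
  moreover have "disjoint_family_at_scale d r (\<U> i)" if i: "i \<le> n" for i
    unfolding disjoint_family_at_scale_def
  proof (intro ballI impI)
    fix U V x y assume *: "U \<in> \<U> i" "V \<in> \<U> i" "U \<noteq> V" "x \<in> U" "y \<in> V"
    then have xy: "x \<in> X i \<inter> carrier G" "y \<in> X i \<inter> carrier G" "U = piece i x" "V = piece i y"
      by (auto simp: \<U>_def piece_def)
    then have "f i x \<noteq> f i y" using \<open>U \<noteq> V\<close> by (auto simp: piece_def)
    then have "(x, y) \<notin> E" using f(1)[OF i] xy by blast
    then show "d x y > r" using xy by (auto simp: E_def)
  qed
  ultimately show "\<exists>R \<U>. (\<Union>i\<le>n. \<Union> (\<U> i)) = carrier G \<and>
      (\<forall>i\<le>n. bounded_family d R (\<U> i) \<and> disjoint_family_at_scale d r (\<U> i))"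
    by (intro exI[of _ R] exI[of _ \<U>]) simp
qed

text \<open>Every finitely generated subgroup inherits the bound of the ambient group.\<close>

lemma (in group) group_asdim_le:
  assumes dim: "group_coarse_asdim_le G n"
  shows "group_asdim G \<le> enat n"
  unfolding group_asdim_def
proof (rule SUP_least)
  fix S assume "S \<in> {S. finite S \<and> S \<subseteq> carrier G}"
  then have S: "finite S" "S \<subseteq> carrier G" by auto
  let ?H = "subgroup_generated G S"
  have sub: "subgroup (generate G S) G" by (rule generate_is_subgroup[OF S(2)])
  have H: "?H = G\<lparr>carrier := generate G S\<rparr>"
    using S(2) by (simp add: subgroup_generated_def Int_absorb1)
  have S_H: "S \<subseteq> generate G S" by (auto intro: generate.incl)
  have grp: "group ?H" unfolding H by (rule subgroup_imp_group[OF sub])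
  have "carrier ?H = generate ?H S"
    unfolding H generate_consistent[OF S_H sub] by simp
  then obtain d where d: "proper_left_invariant_metric ?H d"
    using ex_proper_left_invariant_metric[OF grp S(1)] S_H by (auto simp: H)
  have "group_coarse_asdim_le ?H n"
    unfolding H by (rule group_coarse_asdim_le_subgroup[OF dim sub])
  then have "asdim_le (carrier ?H) d n"
    by (rule coarse_asdim_imp_asdim_le[OF grp d])
  then have "asdim (carrier ?H) d \<le> enat n"
    unfolding asdim_def by (intro Inf_lower) blast
  then show "countable_group_asdim ?H \<le> enat n"
    using countable_group_asdim_eq[OF grp d] by simp
qed

theorem theorem3p4:
  fixes G :: "('a, 'b) monoid_scheme"
  assumes "group G" and "solvable G"
  shows "group_asdim G \<le> hirsch_length G"
proof (cases "hirsch_length G = \<infinity>")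
  case False
  interpret group G by fact
  let ?n = "derived_length G"
  let ?v = "\<lambda>i. vdim (class_ring :: rat ring)
    (rat_tensor (G\<lparr>carrier := derived_series G i\<rparr> Mod derived_series G (Suc i)))"
  have "\<exists>n. derived_series G n = {\<one>\<^bsub>G\<^esub>}"
    using \<open>solvable G\<close> solvable_iff_trivial_derived_seq by (simp add: derived_series_def)
  then have triv: "derived_series G ?n = {\<one>\<^bsub>G\<^esub>}"
    unfolding derived_length_def by (rule LeastI_ex)
  have h: "hirsch_length G = (\<Sum>i<?n. ?v i)" by (simp add: hirsch_length_def)
  have v: "?v i = enat (the_enat (?v i))" if "i < ?n" for i
  proof -
    have "?v i \<le> hirsch_length G" unfolding h using that by (intro member_le_sum) auto
    then have "?v i \<noteq> \<infinity>" using False by (metis enat_ord_simps(5))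
    then show ?thesis by auto
  qed
  define r where "r i = the_enat (?v i)" for i
  have sum_enat: "enat (\<Sum>j<n. r j) = (\<Sum>j<n. enat (r j))" for n
    by (induction n) (simp_all add: zero_enat_def flip: plus_enat_simps(1))
  have "group_coarse_asdim_le (G\<lparr>carrier := derived_series G 0\<rparr>) (\<Sum>j=0..<?n. r j)"
    by (rule derived_series_asdim_le[OF triv]) (use v in \<open>simp_all add: r_def\<close>)
  then have "group_coarse_asdim_le G (\<Sum>j<?n. r j)"
    by (simp add: derived_series_def atLeast0LessThan)
  then have "group_asdim G \<le> enat (\<Sum>j<?n. r j)" by (rule group_asdim_le)
  also have "\<dots> = (\<Sum>i<?n. enat (r i))" by (rule sum_enat)
  also have "\<dots> = hirsch_length G" unfolding h by (rule sum.cong) (use v in \<open>auto simp: r_def\<close>)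
  finally show ?thesis .
qed simp

end
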